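(* Let $R>1$, $\omega\ge0$, $f=0$. For $\lambda\in\mathbb{R}$ define on $\overline{\Omega_R}$, with $g_\lambda(t)=\frac{R}{R^2-1}\big(\omega+\frac{\lambda R}{2}\log R\big)\big(t-\frac1t\big)-\frac{\lambda t}{2}\log t$, $$v_\lambda(\xi)=g_\lambda(\rho)\,\widehat\theta,\qquad q_\lambda(\xi)=\int_1^\rho\frac{g_\lambda(t)^2}{t}\,dt-\lambda\theta .$$ Then for every $\lambda\in\mathbb{R}$, $v_\lambda\in C^\infty(\overline{\Omega_R})$ is an incomplete solution of problem (P) with $f=0$, and $q_\lambda$ is its associated pressure, i.e. $$\int_{\Omega_R}\nabla v_\lambda\cdot\nabla\varphi+\int_{\Omega_R}(v_\lambda\cdot\nabla)v_\lambda\cdot\varphi-\int_{\Omega_R}q_\lambda(\nabla\cdot\varphi)=0\qquad\forall\varphi\in\mathbb{H}(\Omega_R).$$ The fields $v_\lambda$ are pairwise distinct for distinct $\lambda$, so (P) with $f=0$ has infinitely many incomplete solutions; and for $\lambda\ne0$ the pressure $q_\lambda$ is discontinuous across $\Sigma_R$ and $q_\lambda\notin H^1(\Omega_R)$.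
   Context: $\Omega_R=\{1<|\xi|<R\}$, polar coordinates $\xi=\rho\widehat\rho$ with $\theta\in[0,2\pi)$, $\widehat\theta=(-\sin\theta,\cos\theta)$. Problem (P): $-\Delta u+(u\cdot\nabla)u+\nabla p=f$, $\nabla\cdot u=0$ in $\Omega_R$, $u=\omega\widehat\theta$ on $|\xi|=R$, $u=0$ on $|\xi|=1$. $\Sigma_R=\{(x,0):1<x<R\}$ with unit normal $\nu=(0,1)$. $H^1_{*,\sigma}(\Omega_R)=\{v\in H^1(\Omega_R;\mathbb{R}^2):v=0\text{ on }|\xi|=1,\ \nabla\cdot v=0\}$; $\mathbb{H}(\Omega_R)=\{v\in H^1_0(\Omega_R;\mathbb{R}^2):\int_{\Sigma_R}v\cdot\nu=0\}$; $\mathbb{H}_\sigma(\Omega_R)=\{v\in\mathbb{H}(\Omega_R):\nabla\cdot v=0\}$. An incomplete solution of (P) is $u\in H^1_{*,\sigma}(\Omega_R)$ with $u=\omega\widehat\theta$ on $|\xi|=R$ and $\int\nabla u\cdot\nabla\varphi+\int(u\cdot\nabla)u\cdot\varphi=\int f\cdot\varphi$ for all $\varphi\in\mathbb{H}_\sigma(\Omega_R)$. *)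

theory Defs
  imports "HOL-Analysis.Analysis"
begin

type_synonym pt = "real \<times> real"

definition annulus :: "real \<Rightarrow> pt set" where
  "annulus R = {\<xi>. 1 < norm \<xi> \<and> norm \<xi> < R}"

definition theta :: "pt \<Rightarrow> real" where
  "theta \<xi> = (THE t. 0 \<le> t \<and> t < 2 * pi \<and> \<xi> = (norm \<xi> * cos t, norm \<xi> * sin t))"

definition theta_hat :: "pt \<Rightarrow> pt" where
  "theta_hat \<xi> = (- sin (theta \<xi>), cos (theta \<xi>))"

coinductive smooth_on :: "pt set \<Rightarrow> (pt \<Rightarrow> 'b::euclidean_space) \<Rightarrow> bool" for U where
  "\<lbrakk>\<forall>x\<in>U. f differentiable (at x);
    \<forall>i\<in>Basis. smooth_on U (\<lambda>x. frechet_derivative f (at x) i)\<rbrakk> \<Longrightarrow> smooth_on U f"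

definition smooth_up_to_closure :: "pt set \<Rightarrow> (pt \<Rightarrow> 'b::euclidean_space) \<Rightarrow> bool" where
  "smooth_up_to_closure \<Omega> f \<longleftrightarrow> (\<exists>U. open U \<and> closure \<Omega> \<subseteq> U \<and> smooth_on U f)"

definition test_fun :: "pt set \<Rightarrow> (pt \<Rightarrow> 'b::euclidean_space) \<Rightarrow> bool" where
  "test_fun \<Omega> \<phi> \<longleftrightarrow> smooth_on UNIV \<phi> \<and> compact (closure {x. \<phi> x \<noteq> 0})
      \<and> closure {x. \<phi> x \<noteq> 0} \<subseteq> \<Omega>"

definition L2 :: "pt set \<Rightarrow> (pt \<Rightarrow> real) \<Rightarrow> bool" where
  "L2 \<Omega> u \<longleftrightarrow> u \<in> borel_measurable (lebesgue_on \<Omega>)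
     \<and> integrable (lebesgue_on \<Omega>) (\<lambda>x. (u x)\<^sup>2)"

definition weak_deriv :: "pt set \<Rightarrow> (pt \<Rightarrow> real) \<Rightarrow> pt \<Rightarrow> (pt \<Rightarrow> real) \<Rightarrow> bool" where
  "weak_deriv \<Omega> u i g \<longleftrightarrow> (\<forall>\<phi>::pt \<Rightarrow> real. test_fun \<Omega> \<phi> \<longrightarrow>
      integrable (lebesgue_on \<Omega>) (\<lambda>x. u x * frechet_derivative \<phi> (at x) i)
    \<and> integrable (lebesgue_on \<Omega>) (\<lambda>x. g x * \<phi> x)
    \<and> (LINT x|lebesgue_on \<Omega>. u x * frechet_derivative \<phi> (at x) i)
        = - (LINT x|lebesgue_on \<Omega>. g x * \<phi> x))"

definition H1 :: "pt set \<Rightarrow> (pt \<Rightarrow> real) \<Rightarrow> bool" where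
  "H1 \<Omega> u \<longleftrightarrow> L2 \<Omega> u \<and> (\<forall>i\<in>Basis. \<exists>g. L2 \<Omega> g \<and> weak_deriv \<Omega> u i g)"

text \<open>The (a.e. unique) weak partial derivative.\<close>
definition wd :: "pt set \<Rightarrow> (pt \<Rightarrow> real) \<Rightarrow> pt \<Rightarrow> pt \<Rightarrow> real" where
  "wd \<Omega> u i = (SOME g. L2 \<Omega> g \<and> weak_deriv \<Omega> u i g)"

definition H1v :: "pt set \<Rightarrow> (pt \<Rightarrow> pt) \<Rightarrow> bool" where
  "H1v \<Omega> u \<longleftrightarrow> (\<forall>e\<in>Basis. H1 \<Omega> (\<lambda>x. u x \<bullet> e))"

definition wgrad :: "pt set \<Rightarrow> (pt \<Rightarrow> pt) \<Rightarrow> pt \<Rightarrow> pt \<Rightarrow> pt \<Rightarrow> real" where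
  "wgrad \<Omega> u e i = wd \<Omega> (\<lambda>x. u x \<bullet> e) i"

definition h1_approx :: "pt set \<Rightarrow> (nat \<Rightarrow> pt \<Rightarrow> pt) \<Rightarrow> (pt \<Rightarrow> pt) \<Rightarrow> bool" where
  "h1_approx \<Omega> \<psi>s u \<longleftrightarrow> H1v \<Omega> u \<and> (\<forall>e\<in>Basis.
      (\<lambda>n. LINT x|lebesgue_on \<Omega>. (\<psi>s n x \<bullet> e - u x \<bullet> e)\<^sup>2) \<longlonglongrightarrow> 0
    \<and> (\<forall>i\<in>Basis. (\<lambda>n. LINT x|lebesgue_on \<Omega>.
          (frechet_derivative (\<psi>s n) (at x) i \<bullet> e - wgrad \<Omega> u e i x)\<^sup>2) \<longlonglongrightarrow> 0))"

definition H10v :: "pt set \<Rightarrow> (pt \<Rightarrow> pt) \<Rightarrow> bool" where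
  "H10v \<Omega> u \<longleftrightarrow> H1v \<Omega> u \<and> (\<exists>\<psi>s. (\<forall>n. test_fun \<Omega> (\<psi>s n)) \<and> h1_approx \<Omega> \<psi>s u)"

definition div_free :: "pt set \<Rightarrow> (pt \<Rightarrow> pt) \<Rightarrow> bool" where
  "div_free \<Omega> u \<longleftrightarrow> (AE x in lebesgue_on \<Omega>. (\<Sum>i\<in>Basis. wgrad \<Omega> u i i x) = 0)"

text \<open>Trace of u on the circle |xi| = r equals h (in L2 of the circle), defined via
  approximation by fields smooth up to the boundary (continuous extension of restriction).\<close>
definition trace_circle :: "pt set \<Rightarrow> real \<Rightarrow> (pt \<Rightarrow> pt) \<Rightarrow> (pt \<Rightarrow> pt) \<Rightarrow> bool" where
  "trace_circle \<Omega> r u h \<longleftrightarrow> (\<exists>\<psi>s. (\<forall>n. smooth_up_to_closure \<Omega> (\<psi>s n)) \<and> h1_approx \<Omega> \<psi>s u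
     \<and> (\<lambda>n. integral {0..2*pi} (\<lambda>t. (norm (\<psi>s n (r * cos t, r * sin t)
                                        - h (r * cos t, r * sin t)))\<^sup>2)) \<longlonglongrightarrow> 0)"

text \<open>Flux of v through Sigma_R = {(x,0) : 1 < x < R} with normal nu = (0,1) vanishes
  (trace defined via approximation by test fields).\<close>
definition zero_flux_Sigma :: "real \<Rightarrow> (pt \<Rightarrow> pt) \<Rightarrow> bool" where
  "zero_flux_Sigma R v \<longleftrightarrow> (\<exists>\<psi>s. (\<forall>n. test_fun (annulus R) (\<psi>s n)) \<and> h1_approx (annulus R) \<psi>s v
     \<and> (\<lambda>n. integral {1..R} (\<lambda>x. \<psi>s n (x, 0) \<bullet> (0, 1))) \<longlonglongrightarrow> 0)"

definition H1star_sigma :: "real \<Rightarrow> (pt \<Rightarrow> pt) \<Rightarrow> bool" where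
  "H1star_sigma R u \<longleftrightarrow> H1v (annulus R) u \<and> trace_circle (annulus R) 1 u (\<lambda>_. 0)
      \<and> div_free (annulus R) u"

definition HH :: "real \<Rightarrow> (pt \<Rightarrow> pt) \<Rightarrow> bool" where
  "HH R v \<longleftrightarrow> H10v (annulus R) v \<and> zero_flux_Sigma R v"

definition HH_sigma :: "real \<Rightarrow> (pt \<Rightarrow> pt) \<Rightarrow> bool" where
  "HH_sigma R v \<longleftrightarrow> HH R v \<and> div_free (annulus R) v"

definition dirichlet :: "real \<Rightarrow> (pt \<Rightarrow> pt) \<Rightarrow> (pt \<Rightarrow> pt) \<Rightarrow> real" where
  "dirichlet R u \<phi> = (LINT x|lebesgue_on (annulus R).
      (\<Sum>e\<in>Basis. \<Sum>i\<in>Basis. wgrad (annulus R) u e i x * wgrad (annulus R) \<phi> e i x))"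

definition convective :: "real \<Rightarrow> (pt \<Rightarrow> pt) \<Rightarrow> (pt \<Rightarrow> pt) \<Rightarrow> real" where
  "convective R u \<phi> = (LINT x|lebesgue_on (annulus R).
      (\<Sum>e\<in>Basis. \<Sum>i\<in>Basis. (u x \<bullet> i) * wgrad (annulus R) u e i x * (\<phi> x \<bullet> e)))"

definition pressure_term :: "real \<Rightarrow> (pt \<Rightarrow> real) \<Rightarrow> (pt \<Rightarrow> pt) \<Rightarrow> real" where
  "pressure_term R q \<phi> = (LINT x|lebesgue_on (annulus R).
      q x * (\<Sum>i\<in>Basis. wgrad (annulus R) \<phi> i i x))"

definition incomplete_solution :: "real \<Rightarrow> real \<Rightarrow> (pt \<Rightarrow> pt) \<Rightarrow> (pt \<Rightarrow> pt) \<Rightarrow> bool" where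
  "incomplete_solution R \<omega> f u \<longleftrightarrow> H1star_sigma R u
     \<and> trace_circle (annulus R) R u (\<lambda>\<xi>. \<omega> *\<^sub>R theta_hat \<xi>)
     \<and> (\<forall>\<phi>. HH_sigma R \<phi> \<longrightarrow>
          dirichlet R u \<phi> + convective R u \<phi>
            = (LINT x|lebesgue_on (annulus R). f x \<bullet> \<phi> x))"

definition is_pressure :: "real \<Rightarrow> (pt \<Rightarrow> pt) \<Rightarrow> (pt \<Rightarrow> real) \<Rightarrow> bool" where
  "is_pressure R u q \<longleftrightarrow> (\<forall>\<phi>. HH R \<phi> \<longrightarrow>
      dirichlet R u \<phi> + convective R u \<phi> - pressure_term R q \<phi> = 0)"

definition g_lam :: "real \<Rightarrow> real \<Rightarrow> real \<Rightarrow> real \<Rightarrow> real" where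
  "g_lam R \<omega> lam t = R / (R\<^sup>2 - 1) * (\<omega> + lam * R / 2 * ln R) * (t - 1 / t) - lam * t / 2 * ln t"

definition v_lam :: "real \<Rightarrow> real \<Rightarrow> real \<Rightarrow> pt \<Rightarrow> pt" where
  "v_lam R \<omega> lam \<xi> = g_lam R \<omega> lam (norm \<xi>) *\<^sub>R theta_hat \<xi>"

definition q_lam :: "real \<Rightarrow> real \<Rightarrow> real \<Rightarrow> pt \<Rightarrow> real" where
  "q_lam R \<omega> lam \<xi> = integral {1..norm \<xi>} (\<lambda>t. (g_lam R \<omega> lam t)\<^sup>2 / t) - lam * theta \<xi>"

end

theory Submission
  imports Defs
begin

text \<open>In Cartesian coordinates v = (-y k, x k) with k = g/rho a function of x^2 + y^2 alone, and off the slit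
  v and q solve the stationary Navier-Stokes system classically. Integrating by parts along lines, the
  pressure term picks up only the jump of the angle across the slit, so for a test field psi the weak form
  equals 2 pi lambda times the flux of psi through the slit; it vanishes in the limit for fields of zero
  flux. The fundamental lemma of the calculus of variations identifies the weak derivatives chosen by SOME
  with the classical ones. If q were in H^1, testing its weak y-derivative against bumps concentrating on
  the slit would force the jump 2 pi lambda to vanish.\<close>

section \<open>Smooth functions from algebras closed under differentiation\<close>


text \<open>The profile g solves g'' + g'/t - g/t^2 = -lambda/t, the azimuthal equation driven by
  the pressure -lambda theta: -(lambda/2) t log t is a particular solution, t - 1/t is the
  homogeneous solution vanishing at t = 1, and its coefficient is fixed by g(R) = omega. The radial
  integral in q balances the centripetal term g^2/t. Two features of the definitions shape the
  proof. Smoothness is coinductive, so it is obtained from classes of functions that contain their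
  own partial derivatives. Fields in \<open>HH\<close> are known only as limits of test fields whose
  values and first derivatives converge in L2, and weak gradients are fixed only up to null sets.
  Therefore the identity is first proved with all derivatives on the coefficients; the limit then
  pairs L2-convergent sequences with bounded coefficients. The pressure is bounded, so it survives
  this limit although it has no weak gradient in L2.\<close>

lemma Basis_pt: "(Basis :: pt set) = {(1,0),(0,1)}"
  by (auto simp: Basis_prod_def)

lemma sum_Basis_pt: "(\<Sum>i\<in>(Basis::pt set). f i) = f (1,0) + f (0,1)"
  by (simp add: Basis_pt)

text \<open>Both partials are explicit functions, so gradients of compound expressions can be
  assembled by resolution and normalised afterwards by \<open>has_grad_cong\<close>.\<close>

definition has_grad :: "pt set \<Rightarrow> (pt \<Rightarrow> real) \<Rightarrow> (pt \<Rightarrow> real) \<Rightarrow> (pt \<Rightarrow> real) \<Rightarrow> bool" where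
  "has_grad U f f1 f2 \<longleftrightarrow> (\<forall>x\<in>U. (f has_derivative (\<lambda>h. f1 x * fst h + f2 x * snd h)) (at x))"

lemma has_gradD: "has_grad U f f1 f2 \<Longrightarrow> x \<in> U \<Longrightarrow> (f has_derivative (\<lambda>h. f1 x * fst h + f2 x * snd h)) (at x)"
  by (auto simp: has_grad_def)

lemma has_grad_const: "has_grad U (\<lambda>x. c) (\<lambda>x. 0) (\<lambda>x. 0)"
  by (auto simp: has_grad_def)

lemma has_grad_fst: "has_grad U fst (\<lambda>x. 1) (\<lambda>x. 0)"
  by (auto simp: has_grad_def intro!: derivative_eq_intros)

lemma has_grad_snd: "has_grad U snd (\<lambda>x. 0) (\<lambda>x. 1)"
  by (auto simp: has_grad_def intro!: derivative_eq_intros)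

lemma has_grad_add:
  "has_grad U f f1 f2 \<Longrightarrow> has_grad U g g1 g2 \<Longrightarrow>
    has_grad U (\<lambda>x. f x + g x) (\<lambda>x. f1 x + g1 x) (\<lambda>x. f2 x + g2 x)"
  unfolding has_grad_def by (auto intro!: derivative_eq_intros simp: algebra_simps)

lemma has_grad_mult:
  "has_grad U f f1 f2 \<Longrightarrow> has_grad U g g1 g2 \<Longrightarrow>
    has_grad U (\<lambda>x. f x * g x) (\<lambda>x. f1 x * g x + f x * g1 x) (\<lambda>x. f2 x * g x + f x * g2 x)"
  unfolding has_grad_def
  by (auto intro!: derivative_eq_intros simp: algebra_simps)

lemma has_grad_chain:
  assumes "has_grad U f f1 f2" "\<And>x. x \<in> U \<Longrightarrow> (h has_real_derivative h' (f x)) (at (f x))"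
  shows "has_grad U (\<lambda>x. h (f x)) (\<lambda>x. h' (f x) * f1 x) (\<lambda>x. h' (f x) * f2 x)"
  unfolding has_grad_def
proof
  fix x assume x: "x \<in> U"
  have "(h has_derivative (*) (h' (f x))) (at (f x))"
    using assms(2)[OF x] by (simp add: has_field_derivative_def)
  from has_derivative_compose[OF has_gradD[OF assms(1) x] this]
  show "((\<lambda>x. h (f x)) has_derivative (\<lambda>ha. h' (f x) * f1 x * fst ha + h' (f x) * f2 x * snd ha)) (at x)"
    by (simp add: algebra_simps)
qed

text \<open>The algebra of functions generated by \<open>B\<close> and the constants. By the sum and
  product rules it is closed under partial derivatives as soon as the partials of the generators lie
  in it, which makes it a ready invariant for coinduction.\<close>

inductive_set gen_alg :: "(pt \<Rightarrow> real) set \<Rightarrow> (pt \<Rightarrow> real) set" for B where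
  base: "f \<in> B \<Longrightarrow> f \<in> gen_alg B"
| const: "(\<lambda>x. c) \<in> gen_alg B"
| add: "f \<in> gen_alg B \<Longrightarrow> g \<in> gen_alg B \<Longrightarrow> (\<lambda>x. f x + g x) \<in> gen_alg B"
| mult: "f \<in> gen_alg B \<Longrightarrow> g \<in> gen_alg B \<Longrightarrow> (\<lambda>x. f x * g x) \<in> gen_alg B"

lemma gen_alg_gradI:
  "has_grad U f f1 f2 \<Longrightarrow> f1 \<in> gen_alg B \<Longrightarrow> f2 \<in> gen_alg B \<Longrightarrow> \<exists>f1\<in>gen_alg B. \<exists>f2\<in>gen_alg B. has_grad U f f1 f2"
  by blast

lemma gen_alg_closed_grad:
  assumes "\<And>f. f \<in> B \<Longrightarrow> \<exists>f1\<in>gen_alg B. \<exists>f2\<in>gen_alg B. has_grad U f f1 f2"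
    and "f \<in> gen_alg B"
  shows "\<exists>f1\<in>gen_alg B. \<exists>f2\<in>gen_alg B. has_grad U f f1 f2"
  using assms(2)
proof induction
  case (base f) then show ?case by (rule assms(1))
next
  case (const c) show ?case using has_grad_const gen_alg.const by blast
next
  case (add f g)
  then obtain f1 f2 g1 g2 where *: "f1 \<in> gen_alg B" "f2 \<in> gen_alg B" "g1 \<in> gen_alg B" "g2 \<in> gen_alg B"
    "has_grad U f f1 f2" "has_grad U g g1 g2" by blast
  show ?case
    by (rule gen_alg_gradI[OF has_grad_add[OF *(5,6)]]) (intro gen_alg.intros * add)+
next
  case (mult f g)
  then obtain f1 f2 g1 g2 where *: "f1 \<in> gen_alg B" "f2 \<in> gen_alg B" "g1 \<in> gen_alg B" "g2 \<in> gen_alg B"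
    "has_grad U f f1 f2" "has_grad U g g1 g2" by blast
  show ?case
    by (rule gen_alg_gradI[OF has_grad_mult[OF *(5,6)]]) (intro gen_alg.intros * mult)+
qed

lemma smooth_on_gen_alg:
  fixes F :: "pt \<Rightarrow> 'b::euclidean_space"
  assumes "open U"
    and B: "\<And>f. f \<in> B \<Longrightarrow> \<exists>f1\<in>gen_alg B. \<exists>f2\<in>gen_alg B. has_grad U f f1 f2"
    and F: "\<forall>e\<in>Basis. f e \<in> gen_alg B" "\<forall>x\<in>U. F x = (\<Sum>e\<in>Basis. f e x *\<^sub>R e)"
  shows "smooth_on U F"
proof -
  \<comment> \<open>Agreement with the algebra is asked only on \<open>U\<close>, since nothing is
    known about \<open>frechet_derivative\<close> elsewhere. Openness of \<open>U\<close> ensures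
    that the derivatives at points of \<open>U\<close> see only these values.\<close>
  define X where "X = (\<lambda>F::pt \<Rightarrow> 'b. \<exists>f. (\<forall>e\<in>Basis. f e \<in> gen_alg B) \<and> (\<forall>x\<in>U. F x = (\<Sum>e\<in>Basis. f e x *\<^sub>R e)))"
  have "X F" unfolding X_def using F by blast
  then show ?thesis
  proof (coinduction arbitrary: F)
    case smooth_on
    then obtain f where f: "\<forall>e\<in>Basis. f e \<in> gen_alg B" "\<forall>x\<in>U. F x = (\<Sum>e\<in>Basis. f e x *\<^sub>R e)"
      unfolding X_def by blast
    have "\<forall>e\<in>(Basis::'b set). \<exists>f1 f2. f1 \<in> gen_alg B \<and> f2 \<in> gen_alg B \<and> has_grad U (f e) f1 f2"
      using gen_alg_closed_grad[OF B] f(1) by blast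
    then obtain f1 f2 where d: "\<forall>e\<in>Basis. f1 e \<in> gen_alg B \<and> f2 e \<in> gen_alg B \<and> has_grad U (f e) (f1 e) (f2 e)"
      by metis
    have hd: "(F has_derivative (\<lambda>h. \<Sum>e\<in>Basis. (f1 e x * fst h + f2 e x * snd h) *\<^sub>R e)) (at x)"
      if x: "x \<in> U" for x
    proof (rule has_derivative_transform_within_open[OF _ \<open>open U\<close> x])
      show "((\<lambda>x. \<Sum>e\<in>Basis. f e x *\<^sub>R e) has_derivative
          (\<lambda>h. \<Sum>e\<in>Basis. (f1 e x * fst h + f2 e x * snd h) *\<^sub>R e)) (at x)"
        using d x by (intro has_derivative_sum has_derivative_scaleR_left) (auto simp: has_grad_def)
    qed (use f in auto)
    have fd: "frechet_derivative F (at x) i = (\<Sum>e\<in>Basis. (f1 e x * fst i + f2 e x * snd i) *\<^sub>R e)"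
      if x: "x \<in> U" for x i
      using frechet_derivative_at[OF hd[OF x], symmetric] by (rule fun_cong)
    have "X (\<lambda>x. frechet_derivative F (at x) i)" for i
      unfolding X_def
    proof (intro exI conjI ballI)
      show "(\<lambda>x. f1 e x * fst i + f2 e x * snd i) \<in> gen_alg B" if "e \<in> Basis" for e
        by (intro gen_alg.add gen_alg.mult gen_alg.const) (use d that in auto)
      show "frechet_derivative F (at x) i = (\<Sum>e\<in>Basis. (f1 e x * fst i + f2 e x * snd i) *\<^sub>R e)"
        if "x \<in> U" for x using fd[OF that] .
    qed
    then show ?case using hd unfolding differentiable_def by blast
  qed
qed

lemma smooth_on_gen_alg_real:
  fixes F :: "pt \<Rightarrow> real"
  assumes "open U"
    and B: "\<And>f. f \<in> B \<Longrightarrow> \<exists>f1\<in>gen_alg B. \<exists>f2\<in>gen_alg B. has_grad U f f1 f2"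
    and F: "F \<in> gen_alg B"
  shows "smooth_on U F"
  by (rule smooth_on_gen_alg[OF assms(1) B, of "\<lambda>_. F"]) (use F in auto)

section \<open>Bump functions\<close>

text \<open>For \<open>k = 0\<close> this is the classical flat function exp(-1/t). The powers of
  1/t are included because differentiation produces them: the functions \<open>bump k\<close> are
  closed under derivatives up to linear combination.\<close>

definition bump :: "nat \<Rightarrow> real \<Rightarrow> real" where
  "bump k t = (if t > 0 then inverse t ^ k * exp (- inverse t) else 0)"

lemma bump_tendsto_0: "(bump k \<longlongrightarrow> 0) (at_right 0)"
proof -
  have "((\<lambda>t::real. inverse t ^ k * exp (- inverse t)) \<longlongrightarrow> 0) (at_right 0)"
  proof -
    \<comment> \<open>Substituting u = 1/t turns the limit at 0 from the right into the decay of u^k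
      / exp u at infinity.\<close>
    have "((\<lambda>u::real. u ^ k / exp u) \<longlongrightarrow> 0) at_top" by (rule tendsto_power_div_exp_0)
    then have "((\<lambda>t::real. inverse t ^ k / exp (inverse t)) \<longlongrightarrow> 0) (at_right 0)"
      by (rule filterlim_compose) (rule filterlim_inverse_at_top_right)
    then show ?thesis by (simp add: exp_minus field_simps)
  qed
  then show ?thesis
    by (rule Lim_transform_eventually)
       (auto simp: bump_def eventually_at_filter intro!: always_eventually)
qed

lemma bump_deriv: "(bump k has_real_derivative (- real k * bump (Suc k) t + bump (Suc (Suc k)) t)) (at t)"
proof -
  consider "t > 0" | "t < 0" | "t = 0" by linarith
  then show ?thesis
  proof cases
    case 1
    have "((\<lambda>t. inverse t ^ k * exp (- inverse t)) has_real_derivative (- real k * bump (Suc k) t + bump (Suc (Suc k)) t)) (at t)"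
    proof (rule DERIV_cong)
      show "((\<lambda>t. inverse t ^ k * exp (- inverse t)) has_real_derivative
        real k * inverse t ^ (k - 1) * (- (inverse t * inverse t)) * exp (- inverse t)
          + exp (- inverse t) * (inverse t * inverse t) * inverse t ^ k) (at t)"
        using 1 by (auto intro!: derivative_eq_intros)
      show "real k * inverse t ^ (k - 1) * (- (inverse t * inverse t)) * exp (- inverse t)
          + exp (- inverse t) * (inverse t * inverse t) * inverse t ^ k
        = - real k * bump (Suc k) t + bump (Suc (Suc k)) t"
        using 1 by (cases k) (simp_all add: bump_def algebra_simps)
    qed
    then show ?thesis
      by (rule has_field_derivative_transform_within_open[of _ _ _ "{0<..}"]) (use 1 in \<open>auto simp: bump_def\<close>)
  next
    case 2
    have "((\<lambda>t. 0) has_real_derivative (- real k * bump (Suc k) t + bump (Suc (Suc k)) t)) (at t)"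
      using 2 by (auto simp: bump_def)
    then show ?thesis
      by (rule has_field_derivative_transform_within_open[of _ _ _ "{..<0}"]) (use 2 in \<open>auto simp: bump_def\<close>)
  next
    case 3
    \<comment> \<open>The difference quotient at 0 is again a bump, \<open>bump (Suc k) h\<close>,
      for h > 0, and is 0 for h < 0.\<close>
    have "((\<lambda>h. bump k h / h) \<longlongrightarrow> 0) (at 0)"
    proof -
      have r: "((\<lambda>h. bump k h / h) \<longlongrightarrow> 0) (at_right 0)"
        by (rule Lim_transform_eventually[OF bump_tendsto_0[of "Suc k"]])
           (auto simp: bump_def eventually_at_filter field_simps intro!: always_eventually)
      have l: "((\<lambda>h. bump k h / h) \<longlongrightarrow> 0) (at_left 0)"
        by (rule Lim_transform_eventually[OF tendsto_const])
           (auto simp: bump_def eventually_at_filter intro!: always_eventually)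
      from l r show ?thesis by (simp add: filterlim_split_at)
    qed
    then show ?thesis using 3 by (simp add: DERIV_def bump_def)
  qed
qed

text \<open>Affine arguments have constant partials, so the chain rule stays within the generated
  algebra.\<close>

definition bump_family :: "(pt \<Rightarrow> real) set" where
  "bump_family = {\<lambda>x. bump k (a * fst x + b * snd x + c) | k a b c. True}"

lemma bump_family_grad:
  assumes "f \<in> bump_family"
  shows "\<exists>f1\<in>gen_alg bump_family. \<exists>f2\<in>gen_alg bump_family. has_grad U f f1 f2"
proof -
  obtain k a b c where f: "f = (\<lambda>x. bump k (a * fst x + b * snd x + c))"
    using assms unfolding bump_family_def by blast
  have A: "has_grad U (\<lambda>x. a * fst x + b * snd x + c) (\<lambda>x. a) (\<lambda>x. b)"
    unfolding has_grad_def by (auto intro!: derivative_eq_intros)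
  have m: "(\<lambda>x. bump j (a * fst x + b * snd x + c)) \<in> gen_alg bump_family" for j
    by (rule gen_alg.base) (unfold bump_family_def, blast)
  show ?thesis unfolding f
    by (rule gen_alg_gradI[OF has_grad_chain[OF A bump_deriv]]) (intro gen_alg.intros m)+
qed

lemma bump_nonneg: "0 \<le> bump k t" by (auto simp: bump_def)
lemma bump0_le_1: "bump 0 t \<le> 1" by (auto simp: bump_def)
lemma bump_pos_iff: "bump k t \<noteq> 0 \<longleftrightarrow> t > 0" by (auto simp: bump_def)

lemma bump0_limit: "t > 0 \<Longrightarrow> (\<lambda>n. bump 0 (real (Suc n) * t)) \<longlonglongrightarrow> 1"
proof -
  assume t: "t > 0"
  have "(\<lambda>n. exp (- (inverse (real (Suc n)) * inverse t))) \<longlonglongrightarrow> exp (- (0 * inverse t))"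
    by (intro tendsto_intros LIMSEQ_inverse_real_of_nat)
  then show ?thesis using t by (simp add: bump_def)
qed

text \<open>Supported in [a,b] x [c,d]; letting m and n grow sharpens it to the indicator of the open rectangle.\<close>
definition box_bump :: "real \<Rightarrow> real \<Rightarrow> real \<Rightarrow> real \<Rightarrow> real \<Rightarrow> real \<Rightarrow> pt \<Rightarrow> real" where
  "box_bump m n a b c d x = bump 0 (m * (fst x - a)) * bump 0 (m * (b - fst x))
      * (bump 0 (n * (snd x - c)) * bump 0 (n * (d - snd x)))"

lemma test_fun_box_bump:
  assumes "m > 0" "n > 0" "{a..b} \<times> {c..d} \<subseteq> \<Omega>"
  shows "test_fun \<Omega> (box_bump m n a b c d)"
proof -
  have "(\<lambda>x. bump 0 (m * (fst x - a))) = (\<lambda>x. bump 0 (m * fst x + 0 * snd x + (- m * a)))"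
    "(\<lambda>x. bump 0 (m * (b - fst x))) = (\<lambda>x. bump 0 (-m * fst x + 0 * snd x + m * b))"
    "(\<lambda>x. bump 0 (n * (snd x - c))) = (\<lambda>x. bump 0 (0 * fst x + n * snd x + (- n * c)))"
    "(\<lambda>x. bump 0 (n * (d - snd x))) = (\<lambda>x. bump 0 (0 * fst x + (-n) * snd x + n * d))"
    by (auto simp: algebra_simps)
  then have m: "(\<lambda>x. bump 0 (m * (fst x - a))) \<in> bump_family"
    "(\<lambda>x. bump 0 (m * (b - fst x))) \<in> bump_family"
    "(\<lambda>x. bump 0 (n * (snd x - c))) \<in> bump_family"
    "(\<lambda>x. bump 0 (n * (d - snd x))) \<in> bump_family"
    unfolding bump_family_def by blast+
  have "box_bump m n a b c d \<in> gen_alg bump_family"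
    unfolding box_bump_def[abs_def]
    by (intro gen_alg.mult) (intro gen_alg.base m)+
  then have s: "smooth_on UNIV (box_bump m n a b c d)"
    by (intro smooth_on_gen_alg_real[OF open_UNIV bump_family_grad])
  have "{x. box_bump m n a b c d x \<noteq> 0} \<subseteq> {a..b} \<times> {c..d}"
    using assms by (auto simp: box_bump_def bump_pos_iff zero_less_mult_iff)
  then have *: "closure {x. box_bump m n a b c d x \<noteq> 0} \<subseteq> {a..b} \<times> {c..d}"
    by (intro closure_minimal closed_Times) auto
  moreover have "compact ({a..b} \<times> {c..d})" by (intro compact_Times) auto
  ultimately have "compact (closure {x. box_bump m n a b c d x \<noteq> 0})"
    using compact_Int_closed[OF _ closed_closure] by (metis inf.absorb_iff2)
  with * s assms(3) show ?thesis unfolding test_fun_def by blast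
qed


section \<open>Integration by parts\<close>

text \<open>The regularity that integration by parts uses. Components of vector test fields belong
  to this class by a first-order argument, without renewed coinduction.\<close>

definition C1_compact :: "pt set \<Rightarrow> (pt \<Rightarrow> real) \<Rightarrow> bool" where
  "C1_compact \<Omega> \<phi> \<longleftrightarrow> (\<forall>x. \<phi> differentiable (at x))
    \<and> (\<forall>i\<in>Basis. continuous_on UNIV (\<lambda>x. frechet_derivative \<phi> (at x) i))
    \<and> compact (closure {x. \<phi> x \<noteq> 0}) \<and> closure {x. \<phi> x \<noteq> 0} \<subseteq> \<Omega>"

lemma frechet_derivative_inner:
  assumes "\<psi> differentiable (at x)"
  shows "frechet_derivative (\<lambda>x. \<psi> x \<bullet> e) (at x) i = frechet_derivative \<psi> (at x) i \<bullet> e"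
proof -
  have "((\<lambda>x. \<psi> x \<bullet> e) has_derivative (\<lambda>i. frechet_derivative \<psi> (at x) i \<bullet> e)) (at x)"
    using assms frechet_derivative_works by (intro has_derivative_inner_left) blast
  then show ?thesis by (metis frechet_derivative_at)
qed

lemma smooth_onD:
  assumes "smooth_on U f"
  shows "x \<in> U \<Longrightarrow> f differentiable (at x)"
    and "i \<in> Basis \<Longrightarrow> smooth_on U (\<lambda>x. frechet_derivative f (at x) i)"
  using assms by (auto elim: smooth_on.cases)

lemma smooth_on_continuous:
  assumes "smooth_on U f" shows "continuous_on U f"
  using smooth_onD(1)[OF assms] differentiable_imp_continuous_within
  by (blast intro: continuous_at_imp_continuous_on)

lemma test_fun_C1_compact:
  assumes "test_fun \<Omega> \<psi>"
  shows "C1_compact \<Omega> (\<lambda>x. \<psi> x \<bullet> e)"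
proof -
  have s: "smooth_on UNIV \<psi>" and c: "compact (closure {x. \<psi> x \<noteq> 0})" "closure {x. \<psi> x \<noteq> 0} \<subseteq> \<Omega>"
    using assms by (auto simp: test_fun_def)
  have d: "\<psi> differentiable (at x)" for x using smooth_onD(1)[OF s] by blast
  have sub: "closure {x. \<psi> x \<bullet> e \<noteq> 0} \<subseteq> closure {x. \<psi> x \<noteq> 0}"
    by (rule closure_mono) auto
  have "compact (closure {x. \<psi> x \<bullet> e \<noteq> 0})"
    using compact_Int_closed[OF c(1) closed_closure] sub by (metis inf.absorb_iff2)
  moreover have "continuous_on UNIV (\<lambda>x. frechet_derivative \<psi> (at x) i \<bullet> e)" if "i \<in> Basis" for i
    by (intro continuous_intros smooth_on_continuous smooth_onD(2)[OF s that])
  moreover have "(\<lambda>x. \<psi> x \<bullet> e) differentiable (at x)" for x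
    using d[of x] unfolding differentiable_def by (blast intro: has_derivative_inner_left)
  ultimately show ?thesis
    using subset_trans[OF sub c(2)] unfolding C1_compact_def frechet_derivative_inner[OF d] by blast
qed

lemma test_fun_C1_compact_real: "test_fun \<Omega> \<phi> \<Longrightarrow> C1_compact \<Omega> \<phi>"
  using test_fun_C1_compact[of \<Omega> \<phi> "1::real"] by simp

lemma C1_compact_deriv:
  assumes "C1_compact \<Omega> \<phi>"
  shows "(\<phi> has_derivative frechet_derivative \<phi> (at x)) (at x)"
  using assms frechet_derivative_works unfolding C1_compact_def by blast

lemma C1_compact_continuous: "C1_compact \<Omega> \<phi> \<Longrightarrow> continuous_on S \<phi>"
  by (intro continuous_at_imp_continuous_on ballI has_derivative_continuous[OF C1_compact_deriv])

lemma C1_compact_zero: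
  assumes "C1_compact \<Omega> \<phi>" "x \<notin> closure {x. \<phi> x \<noteq> 0}"
  shows "\<phi> x = 0" "frechet_derivative \<phi> (at x) i = 0"
proof -
  show "\<phi> x = 0" using assms(2) closure_subset[of "{x. \<phi> x \<noteq> 0}"] by auto
  have "(\<phi> has_derivative (\<lambda>_. 0)) (at x)"
    by (rule has_derivative_transform_within_open[of "\<lambda>_. 0" _ _ _ "- closure {x. \<phi> x \<noteq> 0}"])
      (use assms(2) closure_subset[of "{x. \<phi> x \<noteq> 0}"] in auto)
  then show "frechet_derivative \<phi> (at x) i = 0"
    using frechet_derivative_at by metis
qed

lemma C1_compact_outside:
  assumes "C1_compact \<Omega> \<phi>" "x \<notin> \<Omega>"
  shows "\<phi> x = 0" "frechet_derivative \<phi> (at x) i = 0"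
  using C1_compact_zero[OF assms(1)] assms unfolding C1_compact_def by blast+

lemma compact_support_bounded:
  fixes f :: "pt \<Rightarrow> real"
  assumes "continuous_on UNIV f" "compact K" "\<And>x. x \<notin> K \<Longrightarrow> f x = 0"
  shows "\<exists>C. \<forall>x. \<bar>f x\<bar> \<le> C"
proof -
  have "bounded (f ` K)"
    using assms by (meson compact_continuous_image compact_imp_bounded continuous_on_subset top_greatest)
  then obtain C where C: "\<forall>x\<in>K. \<bar>f x\<bar> \<le> C" unfolding bounded_iff by auto
  have "\<bar>f x\<bar> \<le> max C 0" for x using C assms(3)[of x] by (cases "x \<in> K") (auto simp: max_def)
  then show ?thesis by blast
qed

lemma C1_compact_bounded:
  assumes "C1_compact \<Omega> \<phi>"
  shows "\<exists>C. \<forall>x. \<bar>\<phi> x\<bar> \<le> C" "i \<in> Basis \<Longrightarrow> \<exists>C. \<forall>x. \<bar>frechet_derivative \<phi> (at x) i\<bar> \<le> C"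
proof -
  have K: "compact (closure {x. \<phi> x \<noteq> 0})" using assms by (simp add: C1_compact_def)
  show "\<exists>C. \<forall>x. \<bar>\<phi> x\<bar> \<le> C"
    by (rule compact_support_bounded[OF C1_compact_continuous[OF assms] K C1_compact_zero(1)[OF assms]])
  show "\<exists>C. \<forall>x. \<bar>frechet_derivative \<phi> (at x) i\<bar> \<le> C" if "i \<in> Basis"
    by (rule compact_support_bounded[OF _ K C1_compact_zero(2)[OF assms]]) (use assms that in \<open>simp_all add: C1_compact_def\<close>)
qed

text \<open>Borel rather than Lebesgue measurability of the extension by zero lets Fubini be applied
  over \<open>lborel\<close>. On a bounded domain such functions are integrable and square
  integrable, and they form an algebra.\<close>

definition bounded_borel :: "pt set \<Rightarrow> (pt \<Rightarrow> real) \<Rightarrow> bool" where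
  "bounded_borel \<Omega> u \<longleftrightarrow> (\<lambda>x. indicator \<Omega> x * u x) \<in> borel_measurable borel \<and> (\<exists>C. \<forall>x\<in>\<Omega>. \<bar>u x\<bar> \<le> C)"

lemma bounded_borel_mult: "bounded_borel \<Omega> u \<Longrightarrow> bounded_borel \<Omega> v \<Longrightarrow> bounded_borel \<Omega> (\<lambda>x. u x * v x)"
proof -
  assume u: "bounded_borel \<Omega> u" and v: "bounded_borel \<Omega> v"
  have "(\<lambda>x. (indicator \<Omega> x * u x) * (indicator \<Omega> x * v x)) \<in> borel_measurable borel"
    by (rule borel_measurable_times) (use u v in \<open>auto simp: bounded_borel_def\<close>)
  also have "(\<lambda>x. (indicator \<Omega> x * u x) * (indicator \<Omega> x * v x)) = (\<lambda>x. indicator \<Omega> x * (u x * v x))"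
    by (auto simp: indicator_def)
  finally have m: "(\<lambda>x. indicator \<Omega> x * (u x * v x)) \<in> borel_measurable borel" .
  obtain C D where "\<forall>x\<in>\<Omega>. \<bar>u x\<bar> \<le> C" "\<forall>x\<in>\<Omega>. \<bar>v x\<bar> \<le> D" using u v unfolding bounded_borel_def by blast
  then have "\<forall>x\<in>\<Omega>. \<bar>u x * v x\<bar> \<le> C * D"
    by (auto simp: abs_mult intro!: mult_mono intro: order_trans[OF abs_ge_zero])
  with m show ?thesis unfolding bounded_borel_def by blast
qed

lemma bounded_borel_add: "bounded_borel \<Omega> u \<Longrightarrow> bounded_borel \<Omega> v \<Longrightarrow> bounded_borel \<Omega> (\<lambda>x. u x + v x)"
proof -
  assume u: "bounded_borel \<Omega> u" and v: "bounded_borel \<Omega> v"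
  have "(\<lambda>x. (indicator \<Omega> x * u x) + (indicator \<Omega> x * v x)) \<in> borel_measurable borel"
    by (rule borel_measurable_add) (use u v in \<open>auto simp: bounded_borel_def\<close>)
  then have m: "(\<lambda>x. indicator \<Omega> x * (u x + v x)) \<in> borel_measurable borel" by (simp add: distrib_left)
  obtain C D where "\<forall>x\<in>\<Omega>. \<bar>u x\<bar> \<le> C" "\<forall>x\<in>\<Omega>. \<bar>v x\<bar> \<le> D" using u v unfolding bounded_borel_def by blast
  then have "\<forall>x\<in>\<Omega>. \<bar>u x + v x\<bar> \<le> C + D"
    by (meson abs_triangle_ineq add_mono order_trans)
  with m show ?thesis unfolding bounded_borel_def by blast
qed

lemma bounded_borel_continuous_compact:
  assumes "\<Omega> \<in> sets borel" "\<Omega> \<subseteq> K" "compact K" "continuous_on K u"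
  shows "bounded_borel \<Omega> u"
proof -
  have "(\<lambda>x. indicator \<Omega> x *\<^sub>R u x) \<in> borel_measurable borel"
    using assms by (intro borel_measurable_continuous_on_indicator) (auto intro: continuous_on_subset)
  moreover have "bounded (u ` K)"
    using assms by (meson compact_continuous_image compact_imp_bounded)
  ultimately show ?thesis using assms(2) unfolding bounded_borel_def bounded_iff by fastforce
qed

lemma bounded_borel_const: "\<Omega> \<in> sets borel \<Longrightarrow> bounded_borel \<Omega> (\<lambda>_. c)"
  unfolding bounded_borel_def by auto

lemma bounded_borel_borel: "\<Omega> \<in> sets borel \<Longrightarrow> u \<in> borel_measurable borel \<Longrightarrow> \<exists>C. \<forall>x. \<bar>u x\<bar> \<le> C \<Longrightarrow> bounded_borel \<Omega> u"
  unfolding bounded_borel_def by (intro conjI borel_measurable_times borel_measurable_indicator) blast+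

lemma bounded_borel_C1_compact:
  assumes "C1_compact \<Omega> \<phi>" "\<Omega> \<in> sets borel"
  shows "bounded_borel \<Omega> \<phi>" "i \<in> Basis \<Longrightarrow> bounded_borel \<Omega> (\<lambda>x. frechet_derivative \<phi> (at x) i)"
proof -
  show "bounded_borel \<Omega> \<phi>"
    by (intro bounded_borel_borel assms(2) borel_measurable_continuous_onI C1_compact_continuous[OF assms(1)] C1_compact_bounded[OF assms(1)])
  show "bounded_borel \<Omega> (\<lambda>x. frechet_derivative \<phi> (at x) i)" if "i \<in> Basis"
    using assms(1) that
    by (intro bounded_borel_borel assms(2) borel_measurable_continuous_onI C1_compact_bounded(2)[OF assms(1)]) (auto simp: C1_compact_def)
qed

lemma bounded_borel_integrable_lborel:
  assumes "bounded \<Omega>" "\<Omega> \<in> sets borel" "bounded_borel \<Omega> u"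
  shows "integrable lborel (\<lambda>x. indicator \<Omega> x * u x)"
proof -
  obtain C where C: "\<forall>x\<in>\<Omega>. \<bar>u x\<bar> \<le> C" using assms(3) unfolding bounded_borel_def by blast
  have fin: "emeasure lborel \<Omega> < \<infinity>" by (rule emeasure_bounded_finite[OF assms(1)])
  show ?thesis
  proof (rule integrableI_bounded_set[where A=\<Omega> and B=C])
    show "AE x\<in>\<Omega> in lborel. norm (indicator \<Omega> x * u x) \<le> C" using C by auto
  qed (use assms fin in \<open>auto simp: bounded_borel_def\<close>)
qed

text \<open>Bridge between the completed measure of the definitions and the Borel measure of Fubini:
  completion does not change integrals of Borel functions.\<close>

lemma lebesgue_on_lborel:
  fixes u :: "pt \<Rightarrow> real"
  assumes "\<Omega> \<in> sets borel" "(\<lambda>x. indicator \<Omega> x * u x) \<in> borel_measurable borel"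
  shows "(LINT x|lebesgue_on \<Omega>. u x) = (LINT x|lborel. indicator \<Omega> x * u x)"
    "integrable (lebesgue_on \<Omega>) u \<longleftrightarrow> integrable lborel (\<lambda>x. indicator \<Omega> x * u x)"
    "u \<in> borel_measurable (lebesgue_on \<Omega>)"
proof -
  have \<Omega>: "\<Omega> \<inter> space lebesgue \<in> sets lebesgue" using assms(1) by auto
  show "(LINT x|lebesgue_on \<Omega>. u x) = (LINT x|lborel. indicator \<Omega> x * u x)"
    using integral_restrict_space[OF \<Omega>, of u] assms(2) by (simp add: integral_completion)
  show "integrable (lebesgue_on \<Omega>) u \<longleftrightarrow> integrable lborel (\<lambda>x. indicator \<Omega> x * u x)"
    using integrable_restrict_space[OF \<Omega>, of u] assms(2) by (simp add: integrable_completion)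
  show "u \<in> borel_measurable (lebesgue_on \<Omega>)"
    using borel_measurable_restrict_space_iff[OF \<Omega>, of u] assms(2)
    by (simp add: measurable_completion mult.commute)
qed

lemma bounded_borel_integrable:
  assumes "bounded \<Omega>" "\<Omega> \<in> sets borel" "bounded_borel \<Omega> u"
  shows "integrable (lebesgue_on \<Omega>) u"
  using bounded_borel_integrable_lborel[OF assms] lebesgue_on_lborel(2)[OF assms(2), of u] assms(3)
  by (simp add: bounded_borel_def)

lemma bounded_borel_measurable:
  assumes "\<Omega> \<in> sets borel" "bounded_borel \<Omega> u"
  shows "u \<in> borel_measurable (lebesgue_on \<Omega>)"
  using lebesgue_on_lborel(3)[OF assms(1), of u] assms(2) by (simp add: bounded_borel_def)

lemma bounded_borel_L2:
  assumes "bounded \<Omega>" "\<Omega> \<in> sets borel" "bounded_borel \<Omega> u"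
  shows "L2 \<Omega> u"
  using bounded_borel_integrable[OF assms(1,2) bounded_borel_mult[OF assms(3,3)]] bounded_borel_measurable[OF assms(2,3)]
  by (simp add: L2_def power2_eq_square)

lemma has_integral_deriv_compact_support:
  fixes f f' :: "real \<Rightarrow> real"
  assumes "\<And>t. (f has_real_derivative f' t) (at t)" "\<And>t. \<bar>t\<bar> > M \<Longrightarrow> f t = 0"
    "\<And>t. \<bar>t\<bar> > M \<Longrightarrow> f' t = 0"
  shows "(f' has_integral 0) UNIV"
proof -
  \<comment> \<open>The added 1 puts both endpoints strictly beyond \<open>M\<close>, where
    \<open>f\<close> vanishes.\<close>
  define N where "N = \<bar>M\<bar> + 1"
  have "(f' has_integral (f N - f (-N))) {-N..N}"
    by (rule fundamental_theorem_of_calculus)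
      (auto simp: N_def has_real_derivative_iff_has_vector_derivative[symmetric]
        intro: has_field_derivative_at_within assms(1))
  then have "(f' has_integral 0) {-N..N}" using assms(2)[of N] assms(2)[of "-N"] by (simp add: N_def)
  then show ?thesis
    by (rule has_integral_on_superset) (auto intro!: assms(3) simp: N_def)
qed

lemma lborel_fubini:
  fixes G :: "pt \<Rightarrow> real"
  assumes "integrable lborel G"
  shows "AE s in lborel. integrable lborel (\<lambda>t. G (s, t))"
    "(LINT x|lborel. G x) = (LINT s|lborel. LINT t|lborel. G (s, t))"
    "AE s in lborel. integrable lborel (\<lambda>t. G (t, s))"
    "(LINT x|lborel. G x) = (LINT s|lborel. LINT t|lborel. G (t, s))"
proof -
  have *: "integrable (lborel \<Otimes>\<^sub>M lborel) (\<lambda>(x,y). G (x, y))" using assms by (simp add: lborel_prod)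
  show "AE s in lborel. integrable lborel (\<lambda>t. G (s, t))"
    using lborel_pair.AE_integrable_fst[OF *] .
  show "(LINT x|lborel. G x) = (LINT s|lborel. LINT t|lborel. G (s, t))"
    using lborel_pair.integral_fst[OF *] by (simp add: lborel_prod)
  show "AE s in lborel. integrable lborel (\<lambda>t. G (t, s))"
    using lborel_pair.AE_integrable_snd[OF *] .
  show "(LINT x|lborel. G x) = (LINT s|lborel. LINT t|lborel. G (t, s))"
    using lborel_pair.integral_snd[OF *] by (simp add: lborel_prod)
qed

lemma has_derivative_line:
  fixes \<phi> :: "pt \<Rightarrow> real"
  assumes "(\<phi> has_derivative D) (at (p + t *\<^sub>R i))"
  shows "((\<lambda>t. \<phi> (p + t *\<^sub>R i)) has_real_derivative D i) (at t)"
proof -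
  have "((\<lambda>t. p + t *\<^sub>R i) has_derivative (\<lambda>h. h *\<^sub>R i)) (at t)"
    by (auto intro!: derivative_eq_intros)
  from has_derivative_compose[OF this assms]
  have "((\<lambda>t. \<phi> (p + t *\<^sub>R i)) has_derivative (\<lambda>h. D (h *\<^sub>R i))) (at t)" .
  moreover have "(\<lambda>h. D (h *\<^sub>R i)) = (*) (D i)"
    using linear_cmul[OF has_derivative_linear[OF assms]] by auto
  ultimately show ?thesis by (simp add: has_field_derivative_def)
qed

text \<open>Here \<open>p s\<close> is the base point of the line with index \<open>s\<close> and
  direction \<open>i\<close>. Taking Fubini as a hypothesis serves both coordinate directions with
  one proof. Differentiability of \<open>u\<close> is asked only along almost every line, which
  admits branches of the angle that jump between lines.\<close>

lemma integration_by_parts_lines: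
  fixes p :: "real \<Rightarrow> pt"
  assumes fub: "\<And>G::pt \<Rightarrow> real. integrable lborel G \<Longrightarrow> AE s in lborel. integrable lborel (\<lambda>t. G (p s + t *\<^sub>R i))"
    "\<And>G::pt \<Rightarrow> real. integrable lborel G \<Longrightarrow> (LINT x|lborel. G x) = (LINT s|lborel. LINT t|lborel. G (p s + t *\<^sub>R i))"
    and i: "i \<in> Basis"
    and \<Omega>: "open \<Omega>" "bounded \<Omega>" and \<phi>: "C1_compact \<Omega> \<phi>" and u: "bounded_borel \<Omega> u" "bounded_borel \<Omega> u'"
    and d: "AE s in lborel. \<forall>t. p s + t *\<^sub>R i \<in> \<Omega> \<longrightarrow>
      ((\<lambda>t. u (p s + t *\<^sub>R i)) has_real_derivative u' (p s + t *\<^sub>R i)) (at t)"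
  shows "(LINT x|lebesgue_on \<Omega>. u x * frechet_derivative \<phi> (at x) i) = - (LINT x|lebesgue_on \<Omega>. u' x * \<phi> x)"
proof -
  define D where "D = (\<lambda>x. frechet_derivative \<phi> (at x) i)"
  define G where "G = (\<lambda>x. indicator \<Omega> x * (u x * D x + u' x * \<phi> x))"
  have \<Omega>b: "\<Omega> \<in> sets borel" using \<Omega>(1) by auto
  have b: "bounded_borel \<Omega> (\<lambda>x. u x * D x)" "bounded_borel \<Omega> (\<lambda>x. u' x * \<phi> x)"
    unfolding D_def by (intro bounded_borel_mult bounded_borel_C1_compact[OF \<phi> \<Omega>b] i u)+
  have G: "integrable lborel G" unfolding G_def
    by (rule bounded_borel_integrable_lborel[OF \<Omega>(2) \<Omega>b bounded_borel_add[OF b]])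
  have i0: "norm i = 1" using i by simp
  obtain B where B: "\<forall>x\<in>\<Omega>. norm x \<le> B" using \<Omega>(2) unfolding bounded_iff by blast
  have "AE s in lborel. (LINT t|lborel. G (p s + t *\<^sub>R i)) = 0"
    using fub(1)[OF G] d
  proof eventually_elim
    case (elim s)
    \<comment> \<open>The product u phi along the line, extended by zero. Its integral of the
      derivative over the whole line is zero, even if the line meets the domain in several
      pieces.\<close>
    define f where "f = (\<lambda>t. indicator \<Omega> (p s + t *\<^sub>R i) * (u (p s + t *\<^sub>R i) * \<phi> (p s + t *\<^sub>R i)))"
    have cont: "continuous_on UNIV (\<lambda>t. p s + t *\<^sub>R i)" by (intro continuous_intros)
    have df: "(f has_real_derivative G (p s + t *\<^sub>R i)) (at t)" for t
    proof (cases "p s + t *\<^sub>R i \<in> \<Omega>")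
      case True
      have "((\<lambda>t. u (p s + t *\<^sub>R i) * \<phi> (p s + t *\<^sub>R i)) has_real_derivative G (p s + t *\<^sub>R i)) (at t)"
        using DERIV_mult[OF elim(2)[rule_format, OF True] has_derivative_line[OF C1_compact_deriv[OF \<phi>]]] True
        by (simp add: G_def D_def algebra_simps)
      then show ?thesis
      proof (rule has_field_derivative_transform_within_open)
        show "open ((\<lambda>t. p s + t *\<^sub>R i) -` \<Omega>)" using open_vimage[OF \<Omega>(1) cont] .
      qed (use True in \<open>auto simp: f_def\<close>)
    next
      case False
      \<comment> \<open>A point outside the domain lies off the closed support of phi, so
        \<open>f\<close> is zero in a neighbourhood, whatever \<open>u\<close> does there.\<close>
      let ?K = "closure {x. \<phi> x \<noteq> 0}"
      have "((\<lambda>t. 0) has_real_derivative G (p s + t *\<^sub>R i)) (at t)" using False by (simp add: G_def)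
      then show ?thesis
      proof (rule has_field_derivative_transform_within_open)
        show "open ((\<lambda>t. p s + t *\<^sub>R i) -` (- ?K))" using open_vimage[OF _ cont] by blast
        show "t \<in> (\<lambda>t. p s + t *\<^sub>R i) -` (- ?K)" using False \<phi> unfolding C1_compact_def by auto
        show "0 = f x" if "x \<in> (\<lambda>t. p s + t *\<^sub>R i) -` (- ?K)" for x
        proof -
          have "\<phi> (p s + x *\<^sub>R i) = 0" by (rule C1_compact_zero(1)[OF \<phi>]) (use that in blast)
          then show ?thesis by (simp add: f_def)
        qed
      qed
    qed
    have out: "p s + t *\<^sub>R i \<notin> \<Omega>" if "\<bar>t\<bar> > B + norm (p s)" for t
    proof
      assume "p s + t *\<^sub>R i \<in> \<Omega>"
      then have "norm (p s + t *\<^sub>R i) \<le> B" using B by blast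
      moreover have "norm (t *\<^sub>R i) \<le> norm (p s + t *\<^sub>R i) + norm (p s)"
        by (metis add_diff_cancel_left' norm_triangle_ineq4)
      ultimately show False using that i0 by simp
    qed
    have "((\<lambda>t. G (p s + t *\<^sub>R i)) has_integral 0) UNIV"
      by (rule has_integral_deriv_compact_support[OF df]) (auto simp: f_def G_def dest: out)
    then show ?case using has_integral_integral_lborel[OF elim(1)] has_integral_unique by blast
  qed
  then have "(LINT s|lborel. LINT t|lborel. G (p s + t *\<^sub>R i)) = 0"
    by (simp add: integral_eq_zero_AE)
  then have "(LINT x|lborel. G x) = 0" using fub(2)[OF G] by simp
  also have "(LINT x|lborel. G x) = (LINT x|lebesgue_on \<Omega>. u x * D x + u' x * \<phi> x)"
    unfolding G_def by (rule lebesgue_on_lborel(1)[OF \<Omega>b, symmetric])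
      (use bounded_borel_add[OF b] in \<open>auto simp: bounded_borel_def\<close>)
  also have "\<dots> = (LINT x|lebesgue_on \<Omega>. u x * D x) + (LINT x|lebesgue_on \<Omega>. u' x * \<phi> x)"
    by (rule Bochner_Integration.integral_add) (use b bounded_borel_integrable[OF \<Omega>(2) \<Omega>b] in auto)
  finally show ?thesis by (simp add: D_def)
qed

lemma integration_by_parts_vertical:
  assumes "open \<Omega>" "bounded \<Omega>" "C1_compact \<Omega> \<phi>" "bounded_borel \<Omega> u" "bounded_borel \<Omega> u'"
    and "AE x in lborel. \<forall>y. (x, y) \<in> \<Omega> \<longrightarrow> ((\<lambda>t. u (x, t)) has_real_derivative u' (x, y)) (at y)"
  shows "(LINT x|lebesgue_on \<Omega>. u x * frechet_derivative \<phi> (at x) (0,1)) = - (LINT x|lebesgue_on \<Omega>. u' x * \<phi> x)"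
  by (rule integration_by_parts_lines[where p="\<lambda>s. (s, 0)" and i="(0,1)"])
    (use assms in \<open>simp_all add: Basis_pt lborel_fubini(1) lborel_fubini(2)[symmetric]\<close>)

lemma integration_by_parts_horizontal:
  assumes "open \<Omega>" "bounded \<Omega>" "C1_compact \<Omega> \<phi>" "bounded_borel \<Omega> u" "bounded_borel \<Omega> u'"
    and "AE y in lborel. \<forall>x. (x, y) \<in> \<Omega> \<longrightarrow> ((\<lambda>t. u (t, y)) has_real_derivative u' (x, y)) (at x)"
  shows "(LINT x|lebesgue_on \<Omega>. u x * frechet_derivative \<phi> (at x) (1,0)) = - (LINT x|lebesgue_on \<Omega>. u' x * \<phi> x)"
  by (rule integration_by_parts_lines[where p="\<lambda>s. (0, s)" and i="(1,0)"])
    (use assms in \<open>simp_all add: Basis_pt lborel_fubini(3) lborel_fubini(4)[symmetric]\<close>)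

lemma has_grad_lines:
  assumes "has_grad U u u1 u2" "(x, y) \<in> U"
  shows "((\<lambda>t. u (t, y)) has_real_derivative u1 (x, y)) (at x)"
    "((\<lambda>t. u (x, t)) has_real_derivative u2 (x, y)) (at y)"
  using has_derivative_line[of u "\<lambda>h. u1 (x, y) * fst h + u2 (x, y) * snd h" "(0, y)" x "(1,0)"]
    has_derivative_line[of u "\<lambda>h. u1 (x, y) * fst h + u2 (x, y) * snd h" "(x, 0)" y "(0,1)"]
    has_gradD[OF assms] by simp_all

lemma integration_by_parts_grad:
  assumes "open \<Omega>" "bounded \<Omega>" "C1_compact \<Omega> \<phi>" "bounded_borel \<Omega> u" "bounded_borel \<Omega> u1" "bounded_borel \<Omega> u2" "has_grad \<Omega> u u1 u2"
  shows "(LINT x|lebesgue_on \<Omega>. u x * frechet_derivative \<phi> (at x) (1,0)) = - (LINT x|lebesgue_on \<Omega>. u1 x * \<phi> x)"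
    "(LINT x|lebesgue_on \<Omega>. u x * frechet_derivative \<phi> (at x) (0,1)) = - (LINT x|lebesgue_on \<Omega>. u2 x * \<phi> x)"
  by (rule integration_by_parts_horizontal[OF assms(1-5)] integration_by_parts_vertical[OF assms(1-4,6)];
    use has_grad_lines[OF assms(7)] in simp)+


section \<open>Weak derivatives\<close>

lemma finite_measure_lebesgue_on:
  "bounded (\<Omega>::pt set) \<Longrightarrow> \<Omega> \<in> sets borel \<Longrightarrow> finite_measure (lebesgue_on \<Omega>)"
  using emeasure_bounded_finite[of \<Omega>]
  by (intro finite_measureI) (simp add: emeasure_restrict_space)

lemma L2_integrable:
  assumes "bounded \<Omega>" "\<Omega> \<in> sets borel" "L2 \<Omega> f"
  shows "integrable (lebesgue_on \<Omega>) f"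
proof -
  interpret finite_measure "lebesgue_on \<Omega>" by (rule finite_measure_lebesgue_on[OF assms(1,2)])
  have "integrable (lebesgue_on \<Omega>) (\<lambda>x. 1 + (f x)\<^sup>2)" using assms(3) by (simp add: L2_def)
  then show ?thesis
  proof (rule Bochner_Integration.integrable_bound)
    have "\<bar>t\<bar> \<le> 1 + t\<^sup>2" for t :: real
      using sum_squares_bound[of 1 "\<bar>t\<bar>"] by simp
    then show "AE x in lebesgue_on \<Omega>. norm (f x) \<le> norm (1 + (f x)\<^sup>2)" by simp
  qed (use assms(3) in \<open>simp add: L2_def\<close>)
qed

lemma L2_mult_integrable:
  assumes "L2 \<Omega> f" "L2 \<Omega> g"
  shows "integrable (lebesgue_on \<Omega>) (\<lambda>x. f x * g x)"
proof -
  have "integrable (lebesgue_on \<Omega>) (\<lambda>x. (f x)\<^sup>2 + (g x)\<^sup>2)" using assms by (simp add: L2_def)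
  then show ?thesis
  proof (rule Bochner_Integration.integrable_bound)
    have "\<bar>a * b\<bar> \<le> a\<^sup>2 + b\<^sup>2" for a b :: real
      using sum_squares_bound[of "\<bar>a\<bar>" "\<bar>b\<bar>"] mult_nonneg_nonneg[OF abs_ge_zero[of a] abs_ge_zero[of b]]
      unfolding abs_mult power2_abs by linarith
    then show "AE x in lebesgue_on \<Omega>. norm (f x * g x) \<le> norm ((f x)\<^sup>2 + (g x)\<^sup>2)" by simp
  next
    show "(\<lambda>x. f x * g x) \<in> borel_measurable (lebesgue_on \<Omega>)"
      using assms unfolding L2_def by (intro borel_measurable_times) auto
  qed
qed

lemma L2_diff:
  assumes "L2 \<Omega> f" "L2 \<Omega> g"
  shows "L2 \<Omega> (\<lambda>x. f x - g x)"
proof -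
  have "integrable (lebesgue_on \<Omega>) (\<lambda>x. (f x)\<^sup>2 + (g x)\<^sup>2 - 2 * (f x * g x))"
    using assms L2_mult_integrable[OF assms] by (simp add: L2_def)
  moreover have "(\<lambda>x. f x - g x) \<in> borel_measurable (lebesgue_on \<Omega>)"
    using assms unfolding L2_def by (intro borel_measurable_diff) auto
  ultimately show ?thesis by (simp add: L2_def power2_diff mult.assoc)
qed

lemma bounded_borel_L2_integrable:
  assumes "bounded \<Omega>" "\<Omega> \<in> sets borel" "bounded_borel \<Omega> w" "L2 \<Omega> f"
  shows "integrable (lebesgue_on \<Omega>) (\<lambda>x. w x * f x)"
  using L2_mult_integrable[OF bounded_borel_L2[OF assms(1-3)] assms(4)] .

text \<open>Weak convergence against a bounded weight. On a finite measure space the inequality |t|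
  <= eps + t^2/eps takes the place of Cauchy-Schwarz: first eps is made small, then n large.\<close>

lemma L2_limit:
  assumes \<Omega>: "bounded \<Omega>" "\<Omega> \<in> sets borel" and w: "bounded_borel \<Omega> w" and L2: "\<And>n. L2 \<Omega> (f n)" "L2 \<Omega> g"
    and lim: "(\<lambda>n. LINT x|lebesgue_on \<Omega>. (f n x - g x)\<^sup>2) \<longlonglongrightarrow> 0"
  shows "(\<lambda>n. LINT x|lebesgue_on \<Omega>. w x * f n x) \<longlonglongrightarrow> (LINT x|lebesgue_on \<Omega>. w x * g x)"
proof -
  let ?M = "lebesgue_on \<Omega>"
  interpret finite_measure ?M by (rule finite_measure_lebesgue_on[OF \<Omega>])
  obtain C where "\<forall>x\<in>\<Omega>. \<bar>w x\<bar> \<le> C" using w unfolding bounded_borel_def by blast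
  then obtain C where C: "\<And>x. x \<in> \<Omega> \<Longrightarrow> \<bar>w x\<bar> \<le> C" "C > 0"
    by (metis less_max_iff_disj max.coboundedI1 zero_less_one)
  note d = L2_diff[OF L2]
  let ?e = "\<lambda>n. LINT x|?M. (f n x - g x)\<^sup>2"
  have bound: "\<bar>(LINT x|?M. w x * f n x) - (LINT x|?M. w x * g x)\<bar> \<le> C * (\<epsilon> * measure ?M (space ?M) + ?e n / \<epsilon>)"
    if "\<epsilon> > 0" for n \<epsilon>
  proof -
    have "(LINT x|?M. w x * f n x) - (LINT x|?M. w x * g x) = (LINT x|?M. w x * (f n x - g x))"
      using bounded_borel_L2_integrable[OF \<Omega> w] L2 by (simp add: right_diff_distrib)
    also have "\<bar>\<dots>\<bar> \<le> (LINT x|?M. \<bar>w x * (f n x - g x)\<bar>)" by (rule integral_abs_bound)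
    also have "\<dots> \<le> (LINT x|?M. C * (\<epsilon> + (f n x - g x)\<^sup>2 / \<epsilon>))"
    proof (rule integral_mono)
      show "integrable ?M (\<lambda>x. \<bar>w x * (f n x - g x)\<bar>)"
        using bounded_borel_L2_integrable[OF \<Omega> w d] by simp
      show "integrable ?M (\<lambda>x. C * (\<epsilon> + (f n x - g x)\<^sup>2 / \<epsilon>))" using d by (simp add: L2_def)
      fix x assume "x \<in> space ?M"
      then have x: "x \<in> \<Omega>" by simp
      have "\<bar>t\<bar> \<le> \<epsilon> + t\<^sup>2 / \<epsilon>" for t :: real
      proof -
        have "\<epsilon> * \<bar>t\<bar> \<le> \<epsilon>\<^sup>2 + t\<^sup>2" using sum_squares_bound[of \<epsilon> "\<bar>t\<bar>"] mult_nonneg_nonneg[of \<epsilon> "\<bar>t\<bar>"] that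
            unfolding power2_abs by linarith
        then show ?thesis using that by (simp add: field_simps power2_eq_square)
      qed
      then show "\<bar>w x * (f n x - g x)\<bar> \<le> C * (\<epsilon> + (f n x - g x)\<^sup>2 / \<epsilon>)"
        unfolding abs_mult using C x by (intro mult_mono) auto
    qed
    also have "\<dots> = C * (\<epsilon> * measure ?M (space ?M) + ?e n / \<epsilon>)"
      using d by (simp add: L2_def mult.commute)
    finally show ?thesis .
  qed
  \<comment> \<open>One is added so that division by \<open>?m\<close> is safe even when the measure
    is zero.\<close>
  let ?m = "measure ?M (space ?M) + 1"
  have m: "?m > 0" by (simp add: add_nonneg_pos)
  show ?thesis
  proof (rule LIMSEQ_I)
    fix r :: real assume r: "r > 0"
    \<comment> \<open>With this choice the term with eps is at most r/2; the threshold r eps / (2 C)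
      for the L2 error keeps the other term below r/2.\<close>
    define \<epsilon> where "\<epsilon> = r / (2 * C * ?m)"
    have \<epsilon>: "\<epsilon> > 0" using r C m by (simp add: \<epsilon>_def)
    have "r * \<epsilon> / (2 * C) > 0" using r C \<epsilon> by simp
    then obtain N where N: "\<And>n. n \<ge> N \<Longrightarrow> \<bar>?e n\<bar> < r * \<epsilon> / (2 * C)"
      using LIMSEQ_D[OF lim] by fastforce
    show "\<exists>no. \<forall>n\<ge>no. norm ((LINT x|?M. w x * f n x) - (LINT x|?M. w x * g x)) < r"
    proof (intro exI allI impI)
      fix n assume "n \<ge> N"
      then have "?e n < r * \<epsilon> / (2 * C)" using N by fastforce
      then have a: "C * (?e n / \<epsilon>) < r / 2" using C \<epsilon> by (simp add: field_simps)
      have "C * (\<epsilon> * measure ?M (space ?M)) \<le> C * (\<epsilon> * ?m)" using C \<epsilon> by simp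
      also have "\<dots> = r / 2" using C m unfolding \<epsilon>_def by simp
      finally show "norm ((LINT x|?M. w x * f n x) - (LINT x|?M. w x * g x)) < r"
        using bound[OF \<epsilon>, of n] a unfolding real_norm_def distrib_left by linarith
    qed
  qed
qed

lemma box_bump_bounds: "0 \<le> box_bump m n a b c d x" "box_bump m n a b c d x \<le> 1"
  unfolding box_bump_def by (intro mult_nonneg_nonneg mult_le_one bump_nonneg bump0_le_1)+

lemma box_bump_limit:
  "(\<lambda>n. box_bump (Suc n) (Suc n) a b c d x) \<longlonglongrightarrow> indicator (box (a,c) (b,d)) x"
proof (cases "x \<in> box (a,c) (b,d)")
  case True
  then have "fst x - a > 0" "b - fst x > 0" "snd x - c > 0" "d - snd x > 0"
    by (auto simp: box_def Basis_pt inner_Pair_0 inner_prod_def)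
  then have "(\<lambda>n. box_bump (Suc n) (Suc n) a b c d x) \<longlonglongrightarrow> 1 * 1 * (1 * 1)"
    unfolding box_bump_def by (intro tendsto_mult bump0_limit)
  then show ?thesis using True by simp
next
  case False
  then have "\<not> (fst x - a > 0 \<and> b - fst x > 0 \<and> snd x - c > 0 \<and> d - snd x > 0)"
    by (auto simp: box_def Basis_pt inner_prod_def)
  then have "box_bump (Suc n) (Suc n) a b c d x = 0" for n
    unfolding box_bump_def using bump_pos_iff[of 0]
    by (smt (verit, del_insts) mult_eq_0_iff of_nat_0_less_iff zero_less_Suc zero_less_mult_iff)
  then show ?thesis using False by simp
qed

text \<open>Bumps increase to the indicator of a rectangle, so \<open>h\<close> has zero integral
  over every closed rectangle in the domain. Lebesgue differentiation then recovers \<open>h\<close>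
  almost everywhere from these integrals.\<close>

lemma fundamental_lemma_calculus_of_variations:
  assumes \<Omega>: "open \<Omega>" and h: "integrable (lebesgue_on \<Omega>) h"
    and test: "\<And>\<phi>::pt \<Rightarrow> real. test_fun \<Omega> \<phi> \<Longrightarrow> (LINT x|lebesgue_on \<Omega>. h x * \<phi> x) = 0"
  shows "AE x in lebesgue_on \<Omega>. h x = 0"
proof -
  define H where "H = (\<lambda>x. indicator \<Omega> x *\<^sub>R h x)"
  have \<Omega>s: "\<Omega> \<inter> space lebesgue \<in> sets lebesgue" using \<Omega> by auto
  have H: "integrable lebesgue H"
    using h integrable_restrict_space[OF \<Omega>s, of h] by (simp add: H_def)
  have Hset: "set_integrable lebesgue (cbox a b) H" for a b
    unfolding set_integrable_def by (rule integrable_mult_indicator[OF _ H]) auto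
  have Hint: "H integrable_on cbox a b" for a b
    by (rule set_lebesgue_integral_eq_integral(1)[OF Hset])
  have zero: "integral (cbox (a,c) (b,d)) H = 0" if sub: "cbox (a,c) (b,d) \<subseteq> \<Omega>" for a b c d
  proof -
    let ?B = "box (a,c) (b,d)"
    have "(\<lambda>n. LINT x|lebesgue_on \<Omega>. h x * box_bump (Suc n) (Suc n) a b c d x)
        \<longlonglongrightarrow> (LINT x|lebesgue_on \<Omega>. h x * indicator ?B x)"
    proof (rule integral_dominated_convergence[where w="\<lambda>x. \<bar>h x\<bar>"])
      show "AE x in lebesgue_on \<Omega>. (\<lambda>n. h x * box_bump (Suc n) (Suc n) a b c d x) \<longlonglongrightarrow> h x * indicator ?B x"
        by (intro AE_I2 tendsto_intros box_bump_limit)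
      show "AE x in lebesgue_on \<Omega>. norm (h x * box_bump (Suc n) (Suc n) a b c d x) \<le> \<bar>h x\<bar>" for n
        by (simp add: abs_mult box_bump_bounds mult_left_le)
      have "?B \<inter> \<Omega> \<in> sets (lebesgue_on \<Omega>)" using \<Omega> by (auto simp: sets_restrict_space_iff)
      then have "indicat_real (?B \<inter> \<Omega>) \<in> borel_measurable (lebesgue_on \<Omega>)" by simp
      then have "indicat_real ?B \<in> borel_measurable (lebesgue_on \<Omega>)"
        by (rule measurable_cong[THEN iffD1, rotated]) (auto simp: indicator_def)
      then show "(\<lambda>x. h x * indicator ?B x) \<in> borel_measurable (lebesgue_on \<Omega>)"
        using h by simp
      show "(\<lambda>x. h x * box_bump (Suc n) (Suc n) a b c d x) \<in> borel_measurable (lebesgue_on \<Omega>)" for n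
      proof -
        have "test_fun UNIV (box_bump (Suc n) (Suc n) a b c d)"
          by (rule test_fun_box_bump) auto
        from C1_compact_continuous[OF test_fun_C1_compact_real[OF this]]
        have "box_bump (Suc n) (Suc n) a b c d \<in> borel_measurable borel"
          by (rule borel_measurable_continuous_onI)
        then have "box_bump (Suc n) (Suc n) a b c d \<in> borel_measurable (lebesgue_on \<Omega>)"
          by (intro measurable_restrict_space1 measurable_completion) simp
        then show ?thesis using h by simp
      qed
    qed (use h in auto)
    moreover have "(LINT x|lebesgue_on \<Omega>. h x * box_bump (Suc n) (Suc n) a b c d x) = 0" for n
      by (rule test[OF test_fun_box_bump]) (use sub in \<open>auto simp: cbox_Pair_eq\<close>)
    ultimately have "(LINT x|lebesgue_on \<Omega>. h x * indicator ?B x) = 0"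
      using LIMSEQ_unique[OF tendsto_const] by (simp add: LIMSEQ_const_iff)
    also have "(LINT x|lebesgue_on \<Omega>. h x * indicator ?B x) = (LINT x|lebesgue. indicator \<Omega> x *\<^sub>R (h x * indicator ?B x))"
      by (rule integral_restrict_space[OF \<Omega>s])
    also have "\<dots> = (LINT x:?B|lebesgue. H x)"
      unfolding set_lebesgue_integral_def H_def by (simp add: mult_ac)
    also have "\<dots> = integral ?B H"
      by (rule set_lebesgue_integral_eq_integral(2)) (unfold set_integrable_def, rule integrable_mult_indicator[OF _ H], auto)
    finally show ?thesis by (simp add: integral_open_interval)
  qed
  \<comment> \<open>Lebesgue differentiation along squares having \<open>x\<close> as lower left
    corner.\<close>
  obtain N where N: "negligible N" and
    leb: "\<And>x e. \<lbrakk>x \<notin> N; 0 < e\<rbrakk> \<Longrightarrow> \<exists>d>0. \<forall>r. 0 < r \<and> r < d \<longrightarrow>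
      norm (integral (cbox x (x + r *\<^sub>R One)) H /\<^sub>R r ^ DIM(pt) - H x) < e"
    using integrable_ccontinuous_explicit[OF Hint] by blast
  have "h x = 0" if x: "x \<in> \<Omega>" "x \<notin> N" for x
  proof (rule ccontr)
    assume "h x \<noteq> 0"
    then obtain d where d: "d > 0" "\<And>r. 0 < r \<Longrightarrow> r < d \<Longrightarrow>
      norm (integral (cbox x (x + r *\<^sub>R One)) H /\<^sub>R r ^ DIM(pt) - H x) < \<bar>h x\<bar>"
      using leb[OF x(2), of "\<bar>h x\<bar>"] by auto
    obtain e where e: "e > 0" "cball x e \<subseteq> \<Omega>" using \<Omega> x(1) open_contains_cball by blast
    \<comment> \<open>In the plane the l1 bound places a square of side \<open>r\<close> within
      distance 2 r of its corner, hence the half of \<open>e\<close>.\<close>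
    define r where "r = min (d/2) (e/2)"
    have r: "0 < r" "r < d" "r \<le> e/2" using d e by (auto simp: r_def)
    have "cbox x (x + r *\<^sub>R One) \<subseteq> cball x e"
    proof
      fix y assume "y \<in> cbox x (x + r *\<^sub>R One)"
      then have "\<bar>(y - x) \<bullet> i\<bar> \<le> r" if "i \<in> Basis" for i
        using that by (auto simp: mem_box inner_simps algebra_simps)
      then have "norm (y - x) \<le> (\<Sum>i\<in>(Basis::pt set). r)"
        by (intro order_trans[OF norm_le_l1] sum_mono) auto
      then show "y \<in> cball x e" using r by (simp add: dist_norm norm_minus_commute)
    qed
    then have "cbox x (x + r *\<^sub>R One) \<subseteq> \<Omega>" using e by blast
    then have "integral (cbox x (x + r *\<^sub>R One)) H = 0"
      using zero[of "fst x" "snd x" "fst (x + r *\<^sub>R One)" "snd (x + r *\<^sub>R One)"]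
      by (simp only: prod.collapse)
    then show False using d(2)[OF r(1,2)] x(1) by (simp add: H_def)
  qed
  moreover have "AE x in lebesgue. x \<notin> N"
    using N by (simp add: negligible_iff_null_sets AE_not_in)
  ultimately have "AE x in lebesgue. x \<in> \<Omega> \<longrightarrow> h x = 0" by auto
  then show ?thesis using AE_restrict_space_iff[OF \<Omega>s] by simp
qed

lemma weak_deriv_unique:
  assumes \<Omega>: "open \<Omega>" "bounded \<Omega>" and g: "L2 \<Omega> g" "L2 \<Omega> h"
    and w: "weak_deriv \<Omega> u i g" "weak_deriv \<Omega> u i h"
  shows "AE x in lebesgue_on \<Omega>. g x = h x"
proof -
  have b: "\<Omega> \<in> sets borel" using \<Omega> by auto
  have "AE x in lebesgue_on \<Omega>. g x - h x = 0"
  proof (rule fundamental_lemma_calculus_of_variations[OF \<Omega>(1)])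
    show "integrable (lebesgue_on \<Omega>) (\<lambda>x. g x - h x)"
      using L2_integrable[OF \<Omega>(2) b] g by simp
    show "(LINT x|lebesgue_on \<Omega>. (g x - h x) * \<phi> x) = 0" if "test_fun \<Omega> \<phi>" for \<phi> :: "pt \<Rightarrow> real"
      using w that unfolding weak_deriv_def by (simp add: left_diff_distrib)
  qed
  then show ?thesis by simp
qed

lemma wd_L2:
  assumes "H1 \<Omega> u" "i \<in> Basis"
  shows "L2 \<Omega> (wd \<Omega> u i)" "weak_deriv \<Omega> u i (wd \<Omega> u i)"
proof -
  have "\<exists>g. L2 \<Omega> g \<and> weak_deriv \<Omega> u i g" using assms unfolding H1_def by blast
  from someI_ex[OF this] show "L2 \<Omega> (wd \<Omega> u i)" "weak_deriv \<Omega> u i (wd \<Omega> u i)"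
    unfolding wd_def by auto
qed

lemma weak_deriv_ibp:
  assumes \<Omega>: "open \<Omega>" "bounded \<Omega>" and b: "bounded_borel \<Omega> u" "bounded_borel \<Omega> g" and i: "i \<in> Basis"
    and ibp: "\<And>\<phi>. C1_compact \<Omega> \<phi> \<Longrightarrow> (LINT x|lebesgue_on \<Omega>. u x * frechet_derivative \<phi> (at x) i) = - (LINT x|lebesgue_on \<Omega>. g x * \<phi> x)"
  shows "weak_deriv \<Omega> u i g"
  unfolding weak_deriv_def
proof (intro allI impI conjI)
  fix \<phi> :: "pt \<Rightarrow> real" assume "test_fun \<Omega> \<phi>"
  then have \<phi>: "C1_compact \<Omega> \<phi>" by (rule test_fun_C1_compact_real)
  have s: "\<Omega> \<in> sets borel" using \<Omega> by auto
  show "integrable (lebesgue_on \<Omega>) (\<lambda>x. u x * frechet_derivative \<phi> (at x) i)"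
    "integrable (lebesgue_on \<Omega>) (\<lambda>x. g x * \<phi> x)"
    by (intro bounded_borel_integrable[OF \<Omega>(2) s] bounded_borel_mult b bounded_borel_C1_compact[OF \<phi> s] i)+
  show "(LINT x|lebesgue_on \<Omega>. u x * frechet_derivative \<phi> (at x) i) = - (LINT x|lebesgue_on \<Omega>. g x * \<phi> x)"
    by (rule ibp[OF \<phi>])
qed

lemma H1_classical:
  assumes \<Omega>: "open \<Omega>" "bounded \<Omega>" and b: "bounded_borel \<Omega> u" "bounded_borel \<Omega> u1" "bounded_borel \<Omega> u2" and g: "has_grad \<Omega> u u1 u2"
  shows "H1 \<Omega> u" "AE x in lebesgue_on \<Omega>. wd \<Omega> u (1,0) x = u1 x" "AE x in lebesgue_on \<Omega>. wd \<Omega> u (0,1) x = u2 x"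
proof -
  have s: "\<Omega> \<in> sets borel" using \<Omega> by auto
  note ibp = integration_by_parts_grad[OF \<Omega> _ b g]
  have w: "weak_deriv \<Omega> u (1,0) u1" "weak_deriv \<Omega> u (0,1) u2"
    using ibp by (auto intro!: weak_deriv_ibp \<Omega> b simp: Basis_pt)
  note L = bounded_borel_L2[OF \<Omega>(2) s]
  show H: "H1 \<Omega> u" unfolding H1_def using w L b by (auto simp: Basis_pt)
  show "AE x in lebesgue_on \<Omega>. wd \<Omega> u (1,0) x = u1 x"
    by (rule weak_deriv_unique[OF \<Omega> wd_L2(1)[OF H] L[OF b(2)] wd_L2(2)[OF H] w(1)]) (auto simp: Basis_pt)
  show "AE x in lebesgue_on \<Omega>. wd \<Omega> u (0,1) x = u2 x"
    by (rule weak_deriv_unique[OF \<Omega> wd_L2(1)[OF H] L[OF b(3)] wd_L2(2)[OF H] w(2)]) (auto simp: Basis_pt)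
qed

section \<open>The annulus and the jump across the slit\<close>

lemma annulus_props: "open (annulus R)" "bounded (annulus R)" "annulus R \<in> sets borel"
proof -
  have "annulus R = {x. 1 < norm x} \<inter> {x. norm x < R}" by (auto simp: annulus_def)
  moreover have "open {x::pt. 1 < norm x}" "open {x::pt. norm x < R}"
    by (intro open_Collect_less continuous_intros)+
  ultimately show "open (annulus R)" by (metis open_Int)
  then show "annulus R \<in> sets borel" by simp
  show "bounded (annulus R)" unfolding bounded_iff annulus_def by (auto intro!: exI[of _ R])
qed

text \<open>On the vertical line with abscissa s > 0, integrating the y-derivative over y < 0 leaves
  only the value at y = 0. Applied with the indicator of the quadrant where the angle exceeds its
  vertical branch by 2 pi, this produces the flux through the slit.\<close>

lemma integral_jump:
  assumes \<phi>: "C1_compact (annulus R) \<phi>"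
  shows "(LINT x|lebesgue_on (annulus R). of_bool (fst x > 0 \<and> snd x < 0) * frechet_derivative \<phi> (at x) (0,1))
    = integral {1..R} (\<lambda>x. \<phi> (x, 0))"
proof -
  let ?\<Omega> = "annulus R"
  note \<Omega> = annulus_props[of R]
  define D where "D = (\<lambda>x. frechet_derivative \<phi> (at x) (0,1))"
  define G where "G = (\<lambda>x::pt. indicator ?\<Omega> x * (of_bool (fst x > 0 \<and> snd x < 0) * D x))"
  \<comment> \<open>The derivative of phi vanishes off the annulus, so the cutoff disappears and the
    fundamental theorem applies on a full segment, even where the line crosses the hole.\<close>
  have G_eq: "G x = of_bool (fst x > 0 \<and> snd x < 0) * D x" for x
    using C1_compact_outside(2)[OF \<phi>, of x] by (auto simp: G_def D_def indicator_def)
  have "bounded_borel ?\<Omega> (\<lambda>x. of_bool (fst x > 0 \<and> snd x < 0))"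
    by (rule bounded_borel_borel[OF \<Omega>(3)]) (auto intro!: exI[of _ 1] simp: borel_prod[symmetric])
  then have b: "bounded_borel ?\<Omega> (\<lambda>x. of_bool (fst x > 0 \<and> snd x < 0) * D x)"
    unfolding D_def using bounded_borel_C1_compact(2)[OF \<phi> \<Omega>(3)] by (intro bounded_borel_mult) (auto simp: Basis_pt)
  have G: "integrable lborel G" unfolding G_def
    by (rule bounded_borel_integrable_lborel[OF \<Omega>(2,3) b])
  have inner: "AE s in lborel. (LINT t|lborel. G (s, t)) = indicator {1..R} s * \<phi> (s, 0)"
    using lborel_fubini(1)[OF G]
  proof eventually_elim
    case (elim s)
    show ?case
    proof (cases "s > 0")
      case False
      then show ?thesis by (simp add: G_eq)
    next
      case True
      define N where "N = \<bar>R\<bar> + 1"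
      have out': "(s, t) \<notin> ?\<Omega>" if "\<bar>t\<bar> \<ge> N" for t
        using norm_snd_le[of t s] that unfolding annulus_def N_def by auto
      have out: "\<phi> (s, -N) = 0"
        by (rule C1_compact_outside(1)[OF \<phi> out']) (simp add: N_def)
      have "((\<lambda>t. D (s, t)) has_integral (\<phi> (s, 0) - \<phi> (s, -N))) {-N..0}"
      proof (rule fundamental_theorem_of_calculus)
        show "((\<lambda>t. \<phi> (s, t)) has_vector_derivative D (s, t)) (at t within {-N..0})" for t
          using has_derivative_line[of \<phi> _ "(s,0)" t "(0,1)", OF C1_compact_deriv[OF \<phi>]]
          unfolding has_real_derivative_iff_has_vector_derivative[symmetric] D_def
          by (simp add: has_field_derivative_at_within)
      qed (simp add: N_def)
      then have "((\<lambda>t. D (s, t)) has_integral \<phi> (s, 0)) {-N..0}" using out by simp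
      then have "((\<lambda>t. G (s, t)) has_integral \<phi> (s, 0)) {-N..0}"
        \<comment> \<open>At t = 0 the strict inequality switches \<open>G\<close> off although
          \<open>D\<close> may be nonzero; one point does not affect the integral.\<close>
        by (rule has_integral_spike_finite[of "{0}", rotated 2]) (use True in \<open>auto simp: G_eq\<close>)
      then have "((\<lambda>t. G (s, t)) has_integral \<phi> (s, 0)) UNIV"
      proof (rule has_integral_on_superset)
        fix t assume t: "t \<notin> {-N..0}"
        have "(s, t) \<notin> ?\<Omega>" if "t < -N"
          by (rule out') (use that in \<open>simp add: N_def\<close>)
        then show "G (s, t) = 0" using t by (auto simp: G_eq D_def C1_compact_outside[OF \<phi>])
      qed simp
      then have "(LINT t|lborel. G (s, t)) = \<phi> (s, 0)"
        using has_integral_integral_lborel[OF elim] has_integral_unique by blast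
      moreover have "\<phi> (s, 0) = 0" if "s \<notin> {1..R}"
        by (rule C1_compact_outside(1)[OF \<phi>]) (use that True in \<open>auto simp: annulus_def\<close>)
      ultimately show ?thesis by (auto simp: indicator_def)
    qed
  qed
  have c: "continuous_on UNIV (\<lambda>s. \<phi> (s, 0))"
    by (rule continuous_on_compose2[OF C1_compact_continuous[OF \<phi>, of UNIV]]) (auto intro!: continuous_intros)
  have "(LINT x|lebesgue_on ?\<Omega>. of_bool (fst x > 0 \<and> snd x < 0) * D x) = (LINT x|lborel. G x)"
    unfolding G_def by (rule lebesgue_on_lborel(1)[OF \<Omega>(3)]) (use b in \<open>auto simp: bounded_borel_def\<close>)
  also have "\<dots> = (LINT s|lborel. LINT t|lborel. G (s, t))" by (rule lborel_fubini(2)[OF G])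
  also have "\<dots> = (LINT s|lborel. indicator {1..R} s * \<phi> (s, 0))"
  proof (rule integral_cong_AE[OF _ _ inner])
    have "(\<lambda>(s, t). G (s, t)) \<in> borel_measurable (lborel \<Otimes>\<^sub>M lborel)"
      using borel_measurable_integrable[OF G] by (simp add: lborel_prod)
    then show "(\<lambda>s. LINT t|lborel. G (s, t)) \<in> borel_measurable lborel"
      by (rule lborel.borel_measurable_lebesgue_integral)
    show "(\<lambda>s. indicator {1..R} s * \<phi> (s, 0)) \<in> borel_measurable lborel"
      using borel_measurable_continuous_onI[OF c] by simp
  qed
  also have "\<dots> = (LINT s:{1..R}|lborel. \<phi> (s, 0))" by (simp add: set_lebesgue_integral_def)
  also have "\<dots> = integral {1..R} (\<lambda>s. \<phi> (s, 0))"
    by (rule set_borel_integral_eq_integral(2), rule borel_integrable_atLeastAtMost')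
      (rule continuous_on_subset[OF c], simp)
  finally show ?thesis by (simp add: D_def)
qed


section \<open>The velocity field and the angle\<close>

definition rsq :: "pt \<Rightarrow> real" where "rsq x = (fst x)\<^sup>2 + (snd x)\<^sup>2"

lemma rsq_pos: "x \<noteq> 0 \<Longrightarrow> rsq x > 0"
  unfolding rsq_def by (cases x) (auto simp: sum_power2_gt_zero_iff zero_prod_def)

lemma norm_rsq: "norm x = sqrt (rsq x)"
  by (cases x) (simp add: norm_Pair rsq_def)

lemma norm_sq_rsq: "(norm x)\<^sup>2 = rsq x"
  by (simp add: norm_rsq rsq_def)

text \<open>The angular velocity g/rho as a function k of the point, and the radial factors in its gradients:
  grad k = m (x, y) and grad m = n (x, y).\<close>
definition kf :: "real \<Rightarrow> real \<Rightarrow> pt \<Rightarrow> real" where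
  "kf A lam x = A * (1 + (-1) * inverse (rsq x)) + (- lam / 4) * ln (rsq x)"
definition mf :: "real \<Rightarrow> real \<Rightarrow> pt \<Rightarrow> real" where
  "mf A lam x = 2 * A * (inverse (rsq x))\<^sup>2 - lam / 2 * inverse (rsq x)"
definition nf :: "real \<Rightarrow> real \<Rightarrow> pt \<Rightarrow> real" where
  "nf A lam x = - 8 * A * (inverse (rsq x))^3 + lam * (inverse (rsq x))\<^sup>2"

lemma has_grad_cong:
  assumes "has_grad U f f1 f2" "open U" "\<And>x. x \<in> U \<Longrightarrow> f x = g x"
    "\<And>x. x \<in> U \<Longrightarrow> f1 x = g1 x" "\<And>x. x \<in> U \<Longrightarrow> f2 x = g2 x"
  shows "has_grad U g g1 g2"
  unfolding has_grad_def
proof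
  fix x assume x: "x \<in> U"
  show "(g has_derivative (\<lambda>h. g1 x * fst h + g2 x * snd h)) (at x)"
    using has_derivative_transform_within_open[OF has_gradD[OF assms(1) x] assms(2) x assms(3)] assms(4,5)[OF x]
    by simp
qed

lemma has_grad_subset: "has_grad U f f1 f2 \<Longrightarrow> V \<subseteq> U \<Longrightarrow> has_grad V f f1 f2"
  by (auto simp: has_grad_def)

lemma has_grad_rsq: "has_grad U rsq (\<lambda>x. 2 * fst x) (\<lambda>x. 2 * snd x)"
  unfolding has_grad_def rsq_def[abs_def] by (auto intro!: derivative_eq_intros)

lemma has_grad_inverse_rsq:
  "has_grad (-{0}) (\<lambda>x. inverse (rsq x)) (\<lambda>x. - (inverse (rsq x))\<^sup>2 * (2 * fst x)) (\<lambda>x. - (inverse (rsq x))\<^sup>2 * (2 * snd x))"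
  by (rule has_grad_chain[OF has_grad_rsq])
    (use rsq_pos in \<open>fastforce intro!: derivative_eq_intros simp: power2_eq_square\<close>)

lemma has_grad_ln_rsq:
  "has_grad (-{0}) (\<lambda>x. ln (rsq x)) (\<lambda>x. inverse (rsq x) * (2 * fst x)) (\<lambda>x. inverse (rsq x) * (2 * snd x))"
  by (rule has_grad_chain[OF has_grad_rsq])
    (use rsq_pos in \<open>auto intro!: derivative_eq_intros simp: divide_inverse\<close>)

lemma open_punctured: "open (- {0::pt})" by auto

lemma has_grad_kf: "has_grad (-{0}) (kf A lam) (\<lambda>x. fst x * mf A lam x) (\<lambda>x. snd x * mf A lam x)"
  unfolding kf_def[abs_def]
  by (rule has_grad_cong[OF has_grad_add[OF has_grad_mult[OF has_grad_const[of _ A] has_grad_add[OF has_grad_const[of _ 1]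
        has_grad_mult[OF has_grad_const[of _ "-1"] has_grad_inverse_rsq]]]
        has_grad_mult[OF has_grad_const[of _ "- lam / 4"] has_grad_ln_rsq]] open_punctured])
    (simp_all add: mf_def algebra_simps)

lemma has_grad_mf: "has_grad (-{0}) (mf A lam) (\<lambda>x. fst x * nf A lam x) (\<lambda>x. snd x * nf A lam x)"
  by (rule has_grad_cong[OF has_grad_add[OF has_grad_mult[OF has_grad_const[of _ "2 * A"]
          has_grad_mult[OF has_grad_inverse_rsq has_grad_inverse_rsq]]
        has_grad_mult[OF has_grad_const[of _ "- lam / 2"] has_grad_inverse_rsq]] open_punctured])
    (simp_all add: mf_def nf_def algebra_simps power2_eq_square power3_eq_cube)

text \<open>Since grad k = m (x, y) and grad m = n (x, y), the Laplacian of (-y k, x k) is (4 m +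
  rho^2 n) (-y, x). The identity says that it equals -lambda times the gradient of the
  angle.\<close>

lemma kmn_identity:
  assumes "x \<noteq> 0"
  shows "4 * mf A lam x + rsq x * nf A lam x = - lam * inverse (rsq x)"
  using rsq_pos[OF assms] by (simp add: mf_def nf_def field_simps power2_eq_square power3_eq_cube)

text \<open>The coefficient that enforces the value omega at rho = R. The differential identities
  hold for every coefficient \<open>A\<close>, so they are stated without reference to this
  value.\<close>

definition Acoef :: "real \<Rightarrow> real \<Rightarrow> real \<Rightarrow> real" where
  "Acoef R \<omega> lam = R / (R\<^sup>2 - 1) * (\<omega> + lam * R / 2 * ln R)"

section \<open>The angle and the Cartesian form of the field\<close>

lemma theta_polar:
  assumes "r > 0" "0 \<le> t" "t < 2 * pi"
  shows "theta (r * cos t, r * sin t) = t"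
proof -
  have n: "norm (r * cos t, r * sin t) = r"
    using assms(1) by (simp add: norm_Pair power_mult_distrib flip: distrib_left)
  show ?thesis unfolding theta_def n
  proof (rule the_equality)
    fix s assume s: "0 \<le> s \<and> s < 2 * pi \<and> (r * cos t, r * sin t) = (r * cos s, r * sin s)"
    then have "sin s = sin t" "cos s = cos t" using assms(1) by auto
    then obtain n :: int where n: "s = t + 2 * pi * n" using sin_cos_eq_iff by blast
    have "\<bar>s - t\<bar> < 2 * pi" using s assms by linarith
    then have "2 * pi * \<bar>real_of_int n\<bar> < 2 * pi * 1" using n by (simp add: abs_mult)
    then have "\<bar>real_of_int n\<bar> < 1" using mult_less_cancel_left_pos[of "2 * pi"] by simp
    then have "n = 0" by linarith
    then show "s = t" using n by simp
  qed (use assms in auto)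
qed

lemma polar_exists:
  assumes "x \<noteq> 0"
  obtains t where "0 \<le> t" "t < 2 * pi" "x = (norm x * cos t, norm x * sin t)" "theta x = t"
proof -
  have n: "norm x > 0" using assms by simp
  have "(fst x / norm x)\<^sup>2 + (snd x / norm x)\<^sup>2 = rsq x / (norm x)\<^sup>2"
    by (simp add: power_divide add_divide_distrib rsq_def)
  also have "\<dots> = 1" using n by (simp add: norm_sq_rsq[symmetric])
  finally obtain t where t: "0 \<le> t" "t < 2 * pi" "fst x / norm x = cos t" "snd x / norm x = sin t"
    using sincos_total_2pi by metis
  then have x: "x = (norm x * cos t, norm x * sin t)" using n by (cases x) (auto simp: field_simps)
  have "theta x = t" using theta_polar[OF n t(1,2)] x by simp
  then show ?thesis using t x that by blast
qed

lemma theta_hat_eq: "x \<noteq> 0 \<Longrightarrow> theta_hat x = (- snd x / norm x, fst x / norm x)"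
proof -
  assume x: "x \<noteq> 0"
  obtain t where "x = (norm x * cos t, norm x * sin t)" "theta x = t" using polar_exists[OF x] by metis
  moreover from this have "fst x = norm x * cos t" "snd x = norm x * sin t" by (metis fst_conv, metis snd_conv)
  ultimately show ?thesis using x by (simp add: theta_hat_def)
qed

lemma g_lam_eq: "x \<noteq> 0 \<Longrightarrow> g_lam R \<omega> lam (norm x) = norm x * kf (Acoef R \<omega> lam) lam x"
proof -
  assume x: "x \<noteq> 0"
  \<comment> \<open>This factor 2 is why lambda/2 in \<open>g_lam\<close> becomes lambda/4 in
    \<open>kf\<close>.\<close>
  have l: "ln (rsq x) = 2 * ln (norm x)"
    using x by (simp add: norm_sq_rsq[symmetric] ln_realpow)
  have "kf (Acoef R \<omega> lam) lam x = Acoef R \<omega> lam * (1 - 1 / (norm x)\<^sup>2) - lam / 2 * ln (norm x)"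
    unfolding kf_def l norm_sq_rsq by (simp add: inverse_eq_divide)
  then show ?thesis using x
    unfolding g_lam_def Acoef_def[symmetric] by (simp add: right_diff_distrib power2_eq_square)
qed

lemma v_lam_eq: "x \<noteq> 0 \<Longrightarrow> v_lam R \<omega> lam x = (- snd x * kf (Acoef R \<omega> lam) lam x, fst x * kf (Acoef R \<omega> lam) lam x)"
  by (simp add: v_lam_def g_lam_eq theta_hat_eq)

text \<open>Generators of an algebra closed under differentiation away from the origin: the partials
  of the logarithm and of the inverse are polynomials in the first three generators.\<close>

definition polar_base :: "(pt \<Rightarrow> real) set" where
  "polar_base = {fst, snd, \<lambda>x. inverse (rsq x), \<lambda>x. ln (rsq x)}"

lemma polar_base_grad:
  assumes "f \<in> polar_base"
  shows "\<exists>f1\<in>gen_alg polar_base. \<exists>f2\<in>gen_alg polar_base. has_grad (-{0}) f f1 f2"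
proof -
  have b: "fst \<in> gen_alg polar_base" "snd \<in> gen_alg polar_base" "(\<lambda>x. inverse (rsq x)) \<in> gen_alg polar_base"
    by (rule gen_alg.base, simp add: polar_base_def)+
  have i: "has_grad (-{0}) (\<lambda>x. inverse (rsq x)) (\<lambda>x. ((-2) * (inverse (rsq x) * inverse (rsq x))) * fst x)
      (\<lambda>x. ((-2) * (inverse (rsq x) * inverse (rsq x))) * snd x)"
    by (rule has_grad_cong[OF has_grad_inverse_rsq open_punctured]) (auto simp: power2_eq_square)
  consider "f = fst" | "f = snd" | "f = (\<lambda>x. inverse (rsq x))" | "f = (\<lambda>x. ln (rsq x))"
    using assms unfolding polar_base_def by blast
  then show ?thesis
  proof cases
    case 1 show ?thesis unfolding 1 by (rule gen_alg_gradI[OF has_grad_fst]) (intro gen_alg.intros)+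
  next
    case 2 show ?thesis unfolding 2 by (rule gen_alg_gradI[OF has_grad_snd]) (intro gen_alg.intros)+
  next
    case 3 show ?thesis unfolding 3 by (rule gen_alg_gradI[OF i]) (intro gen_alg.mult gen_alg.const b)+
  next
    case 4 show ?thesis unfolding 4 by (rule gen_alg_gradI[OF has_grad_ln_rsq]) (intro gen_alg.mult gen_alg.const b)+
  qed
qed

lemma closure_annulus_subset: "closure (annulus R) \<subseteq> {x. 1 \<le> norm x \<and> norm x \<le> R}"
proof (rule closure_minimal)
  show "annulus R \<subseteq> {x. 1 \<le> norm x \<and> norm x \<le> R}" by (auto simp: annulus_def)
  show "closed {x::pt. 1 \<le> norm x \<and> norm x \<le> R}"
    by (intro closed_Collect_conj closed_Collect_le continuous_intros)
qed

lemma smooth_v_lam: "smooth_up_to_closure (annulus R) (v_lam R \<omega> lam)"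
proof -
  define A where "A = Acoef R \<omega> lam"
  have b: "f \<in> gen_alg polar_base" if "f \<in> polar_base" for f using that by (rule gen_alg.base)
  have bb: "fst \<in> gen_alg polar_base" "snd \<in> gen_alg polar_base" "(\<lambda>x. inverse (rsq x)) \<in> gen_alg polar_base"
    "(\<lambda>x. ln (rsq x)) \<in> gen_alg polar_base" by (rule b, simp add: polar_base_def)+
  have k: "kf A lam \<in> gen_alg polar_base" unfolding kf_def[abs_def]
    by (intro gen_alg.add gen_alg.mult gen_alg.const bb)
  \<comment> \<open>Weighting by \<open>fst e\<close> and \<open>snd e\<close> lets one formula
    select the component for either basis vector and remain in the algebra.\<close>
  let ?f = "\<lambda>e x. (-1 * snd x * kf A lam x) * fst e + (fst x * kf A lam x) * snd e"
  have "smooth_on (-{0}) (v_lam R \<omega> lam)"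
  proof (rule smooth_on_gen_alg[OF open_punctured polar_base_grad, where f="?f"])
    show "\<forall>e\<in>Basis. ?f e \<in> gen_alg polar_base"
      by (intro ballI gen_alg.add gen_alg.mult gen_alg.const bb k)
    show "\<forall>x\<in>- {0}. v_lam R \<omega> lam x = (\<Sum>e\<in>Basis. ?f e x *\<^sub>R e)"
      by (auto simp: sum_Basis_pt v_lam_eq A_def)
  qed
  moreover have "closure (annulus R) \<subseteq> - {0}" using closure_annulus_subset[of R] by auto
  ultimately show ?thesis unfolding smooth_up_to_closure_def using open_punctured by blast
qed

text \<open>A compact set containing the annulus and avoiding the origin: continuity on it gives
  bounds on the open annulus.\<close>

definition cannulus :: "real \<Rightarrow> pt set" where "cannulus R = {x. 1 \<le> norm x \<and> norm x \<le> R}"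

lemma compact_cannulus: "compact (cannulus R)"
proof -
  have "cannulus R = cball 0 R - ball 0 1" by (auto simp: cannulus_def)
  then show ?thesis by (simp add: compact_diff)
qed

lemma annulus_subset: "annulus R \<subseteq> cannulus R" "annulus R \<subseteq> - {0}" "x \<in> cannulus R \<Longrightarrow> rsq x > 0"
proof -
  show "annulus R \<subseteq> cannulus R" "annulus R \<subseteq> - {0}" by (auto simp: annulus_def cannulus_def)
  show "x \<in> cannulus R \<Longrightarrow> rsq x > 0" by (rule rsq_pos) (auto simp: cannulus_def)
qed

lemma bounded_borel_annulus: "continuous_on (cannulus R) u \<Longrightarrow> bounded_borel (annulus R) u"
  by (rule bounded_borel_continuous_compact[OF annulus_props(3) annulus_subset(1) compact_cannulus])

lemma continuous_kmn:
  "continuous_on (cannulus R) (kf A lam)" "continuous_on (cannulus R) (mf A lam)" "continuous_on (cannulus R) (nf A lam)"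
  "continuous_on (cannulus R) (\<lambda>x. inverse (rsq x))"
proof -
  have r: "continuous_on (cannulus R) rsq" unfolding rsq_def[abs_def] by (intro continuous_intros)
  have p: "\<forall>x\<in>cannulus R. rsq x \<noteq> 0" "\<forall>x\<in>cannulus R. rsq x > 0" using annulus_subset(3) by force+
  show "continuous_on (cannulus R) (kf A lam)" "continuous_on (cannulus R) (mf A lam)" "continuous_on (cannulus R) (nf A lam)"
    "continuous_on (cannulus R) (\<lambda>x. inverse (rsq x))"
    unfolding kf_def[abs_def] mf_def[abs_def] nf_def[abs_def] by (intro continuous_intros r p)+
qed

section \<open>First and second derivatives of the velocity components\<close>

lemma has_grad_v1:
  "has_grad (-{0}) (\<lambda>x. - snd x * kf A lam x) (\<lambda>x. - fst x * snd x * mf A lam x) (\<lambda>x. - kf A lam x - (snd x)\<^sup>2 * mf A lam x)"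
  by (rule has_grad_cong[OF has_grad_mult[OF has_grad_const[of _ "-1"] has_grad_mult[OF has_grad_snd has_grad_kf[of A lam]]] open_punctured])
    (simp_all add: algebra_simps power2_eq_square)

lemma has_grad_v2:
  "has_grad (-{0}) (\<lambda>x. fst x * kf A lam x) (\<lambda>x. kf A lam x + (fst x)\<^sup>2 * mf A lam x) (\<lambda>x. fst x * snd x * mf A lam x)"
  by (rule has_grad_cong[OF has_grad_mult[OF has_grad_fst has_grad_kf[of A lam]] open_punctured])
    (simp_all add: algebra_simps power2_eq_square)

lemma has_grad_xym:
  "has_grad (-{0}) (\<lambda>x. fst x * snd x * mf A lam x)
    (\<lambda>x. snd x * mf A lam x + (fst x)\<^sup>2 * snd x * nf A lam x) (\<lambda>x. fst x * mf A lam x + fst x * (snd x)\<^sup>2 * nf A lam x)"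
  by (rule has_grad_cong[OF has_grad_mult[OF has_grad_mult[OF has_grad_fst has_grad_snd] has_grad_mf[of A lam]] open_punctured])
    (simp_all add: algebra_simps power2_eq_square)

lemma has_grad_v11:
  "has_grad (-{0}) (\<lambda>x. - fst x * snd x * mf A lam x)
    (\<lambda>x. - snd x * mf A lam x - (fst x)\<^sup>2 * snd x * nf A lam x) (\<lambda>x. - fst x * mf A lam x - fst x * (snd x)\<^sup>2 * nf A lam x)"
  by (rule has_grad_cong[OF has_grad_mult[OF has_grad_const[of _ "-1"] has_grad_xym[of A lam]] open_punctured])
    (simp_all add: algebra_simps power2_eq_square)

lemma has_grad_v21:
  "has_grad (-{0}) (\<lambda>x. kf A lam x + (fst x)\<^sup>2 * mf A lam x)
    (\<lambda>x. 3 * fst x * mf A lam x + (fst x)^3 * nf A lam x) (\<lambda>x. snd x * mf A lam x + (fst x)\<^sup>2 * snd x * nf A lam x)"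
  by (rule has_grad_cong[OF has_grad_add[OF has_grad_kf[of A lam] has_grad_mult[OF has_grad_mult[OF has_grad_fst has_grad_fst] has_grad_mf[of A lam]]] open_punctured])
    (simp_all add: algebra_simps power2_eq_square power3_eq_cube)

lemma has_grad_v12:
  "has_grad (-{0}) (\<lambda>x. - kf A lam x - (snd x)\<^sup>2 * mf A lam x)
    (\<lambda>x. - fst x * mf A lam x - fst x * (snd x)\<^sup>2 * nf A lam x) (\<lambda>x. - 3 * snd x * mf A lam x - (snd x)^3 * nf A lam x)"
  by (rule has_grad_cong[OF has_grad_mult[OF has_grad_const[of _ "-1"] has_grad_add[OF has_grad_kf[of A lam] has_grad_mult[OF has_grad_mult[OF has_grad_snd has_grad_snd] has_grad_mf[of A lam]]]] open_punctured])
    algebra+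

text \<open>Two branches of the angle: thetaH equals theta off the line y = 0 and is differentiable along
  horizontal lines; thetaV is differentiable along vertical lines, across the slit as well, and differs from
  theta by 2 pi below the slit.\<close>
definition thetaH :: "pt \<Rightarrow> real" where
  "thetaH x = (if snd x > 0 then pi / 2 else 3 * pi / 2) - arctan (fst x / snd x)"
definition thetaV :: "pt \<Rightarrow> real" where
  "thetaV x = arctan (snd x / fst x) + pi * of_bool (fst x < 0)"

lemma theta_eq_thetaH:
  assumes "snd x \<noteq> 0"
  shows "theta x = thetaH x"
proof -
  obtain a b where x: "x = (a, b)" by (cases x)
  have b: "b \<noteq> 0" using assms x by simp
  define u where "u = a / b"
  have a: "a = u * b" using b by (simp add: u_def)
  \<comment> \<open>The polar radius of (a, b), written through u = a/b so that the sine and cosine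
    of arctan u can be substituted directly.\<close>
  define r where "r = \<bar>b\<bar> * sqrt (1 + u\<^sup>2)"
  have sp: "sqrt (1 + u\<^sup>2) > 0" by (simp add: add_pos_nonneg)
  have r: "r > 0" using b sp by (simp add: r_def)
  have at: "- (pi/2) < arctan u" "arctan u < pi/2" using arctan_lbound arctan_ubound by auto
  have tr: "cos (arctan u) * sqrt (1 + u\<^sup>2) = 1" "sin (arctan u) * sqrt (1 + u\<^sup>2) = u"
    using sp by (simp_all add: cos_arctan sin_arctan)
  show ?thesis
  proof (cases "b > 0")
    case True
    have "cos (pi/2 - arctan u) = sin (arctan u)" "sin (pi/2 - arctan u) = cos (arctan u)"
      by (simp_all add: cos_diff sin_diff)
    then have "r * cos (pi/2 - arctan u) = a" "r * sin (pi/2 - arctan u) = b"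
      using tr True a by (simp_all add: r_def mult_ac)
    then show ?thesis using theta_polar[OF r, of "pi/2 - arctan u"] at True pi_gt_zero
      by (simp add: x thetaH_def u_def)
  next
    case False
    have "cos (3*pi/2 - arctan u) = - sin (arctan u)" "sin (3*pi/2 - arctan u) = - cos (arctan u)"
      using sin_3over2_pi cos_3over2_pi by (simp_all add: cos_diff sin_diff)
    then have "r * cos (3*pi/2 - arctan u) = a" "r * sin (3*pi/2 - arctan u) = b"
      using tr False b a by (simp_all add: r_def mult_ac)
    then show ?thesis using theta_polar[OF r, of "3*pi/2 - arctan u"] at False pi_gt_zero
      by (simp add: x thetaH_def u_def)
  qed
qed

text \<open>Reciprocal arguments of arctan add up to pi/2 or -pi/2 according to sign; comparing the
  four quadrants with \<open>thetaH\<close> leaves an excess of 2 pi in the fourth one only.\<close>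

lemma theta_eq_thetaV:
  assumes "fst x \<noteq> 0" "snd x \<noteq> 0"
  shows "theta x = thetaV x + 2 * pi * of_bool (fst x > 0 \<and> snd x < 0)"
proof -
  have "arctan (fst x / snd x) = arctan (1 / (snd x / fst x))" by simp
  also have "\<dots> = sgn (snd x / fst x) * pi / 2 - arctan (snd x / fst x)"
    using Transcendental.arctan_inverse[of "snd x / fst x"] assms by auto
  finally have "arctan (fst x / snd x) = sgn (snd x / fst x) * pi / 2 - arctan (snd x / fst x)" .
  then show ?thesis using assms unfolding theta_eq_thetaH[OF assms(2)] thetaH_def thetaV_def
    by (auto simp: sgn_if divide_less_0_iff zero_less_divide_iff not_less)
qed

lemma thetaH_deriv:
  assumes "y \<noteq> 0"
  shows "((\<lambda>t. thetaH (t, y)) has_real_derivative - y * inverse (rsq (x, y))) (at x)"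
proof -
  have "x\<^sup>2 + y\<^sup>2 > 0" "1 + (x/y)\<^sup>2 > 0" using assms by (auto simp: sum_power2_gt_zero_iff add_pos_nonneg)
  then show ?thesis using assms unfolding thetaH_def rsq_def
    by (auto intro!: derivative_eq_intros simp: field_simps power2_eq_square)
qed

lemma thetaV_deriv:
  assumes "x \<noteq> 0"
  shows "((\<lambda>t. thetaV (x, t)) has_real_derivative x * inverse (rsq (x, y))) (at y)"
proof -
  have "x\<^sup>2 + y\<^sup>2 > 0" "1 + (y/x)\<^sup>2 > 0" using assms by (auto simp: sum_power2_gt_zero_iff add_pos_nonneg)
  then show ?thesis using assms unfolding thetaV_def rsq_def
    by (auto intro!: derivative_eq_intros simp: field_simps power2_eq_square)
qed

lemma bounded_borel_thetaHV: "bounded_borel (annulus R) thetaH" "bounded_borel (annulus R) thetaV"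
proof -
  have at: "\<bar>arctan t\<bar> \<le> pi / 2" for t using arctan_bounded[of t] by linarith
  have "\<bar>thetaH x\<bar> \<le> 2 * pi" for x
    using at[of "fst x / snd x"] pi_gt_zero by (auto simp: thetaH_def)
  then have "\<exists>C. \<forall>x. \<bar>thetaH x\<bar> \<le> C" by blast
  moreover have "thetaH \<in> borel_measurable borel"
    unfolding thetaH_def[abs_def] borel_prod[symmetric] by measurable
  ultimately show "bounded_borel (annulus R) thetaH" by (intro bounded_borel_borel annulus_props(3))
  have "\<bar>thetaV x\<bar> \<le> 2 * pi" for x
    using at[of "snd x / fst x"] pi_gt_zero by (auto simp: thetaV_def)
  then have "\<exists>C. \<forall>x. \<bar>thetaV x\<bar> \<le> C" by blast
  moreover have "thetaV \<in> borel_measurable borel"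
    unfolding thetaV_def[abs_def] borel_prod[symmetric] by measurable
  ultimately show "bounded_borel (annulus R) thetaV" by (intro bounded_borel_borel annulus_props(3))
qed

text \<open>The part of the pressure that balances the centripetal acceleration: its gradient is k^2
  (x, y), while the convective term is -k^2 (x, y).\<close>

definition radial_pressure :: "real \<Rightarrow> real \<Rightarrow> real \<Rightarrow> pt \<Rightarrow> real" where
  "radial_pressure R \<omega> lam x = integral {1..norm x} (\<lambda>t. (g_lam R \<omega> lam t)\<^sup>2 / t)"

lemma continuous_g_lam: "continuous_on {1..S} (\<lambda>t. (g_lam R \<omega> lam t)\<^sup>2 / t)"
  unfolding g_lam_def by (intro continuous_intros) auto

lemma has_grad_norm: "has_grad (-{0}) norm (\<lambda>x. fst x / norm x) (\<lambda>x. snd x / norm x)"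
  by (rule has_grad_cong[OF has_grad_chain[OF has_grad_rsq[of "-{0}"], of sqrt "\<lambda>t. inverse (sqrt t) / 2"] open_punctured])
    (use DERIV_real_sqrt[OF rsq_pos] in \<open>simp_all add: norm_rsq inverse_eq_divide mult.commute\<close>)

lemma has_grad_radial_pressure:
  "has_grad (annulus R) (radial_pressure R \<omega> lam)
    (\<lambda>x. fst x * (kf (Acoef R \<omega> lam) lam x)\<^sup>2) (\<lambda>x. snd x * (kf (Acoef R \<omega> lam) lam x)\<^sup>2)"
proof -
  let ?h = "\<lambda>t. (g_lam R \<omega> lam t)\<^sup>2 / t"
  have "((\<lambda>s. integral {1..s} ?h) has_real_derivative ?h t) (at t)" if "1 < t" "t < R" for t
  proof -
    have "((\<lambda>s. integral {1..s} ?h) has_real_derivative ?h t) (at t within {1..R})"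
      by (rule integral_has_real_derivative[OF continuous_g_lam]) (use that in auto)
    moreover have "at t within {1..R} = at t"
      by (rule at_within_Icc_at) (use that in auto)
    ultimately show ?thesis by simp
  qed
  from has_grad_chain[OF has_grad_subset[OF has_grad_norm annulus_subset(2)[of R]], of "\<lambda>s. integral {1..s} ?h" ?h, OF this]
  show ?thesis unfolding radial_pressure_def[abs_def]
  proof (rule has_grad_cong[OF _ annulus_props(1)])
    fix x assume "x \<in> annulus R"
    then have x: "x \<noteq> 0" using annulus_subset(2) by auto
    show "?h (norm x) * (fst x / norm x) = fst x * (kf (Acoef R \<omega> lam) lam x)\<^sup>2"
      "?h (norm x) * (snd x / norm x) = snd x * (kf (Acoef R \<omega> lam) lam x)\<^sup>2"
      unfolding g_lam_eq[OF x] using x by (simp_all add: power2_eq_square)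
  qed (auto simp: annulus_def)
qed

lemma bounded_borel_radial_pressure: "bounded_borel (annulus R) (radial_pressure R \<omega> lam)"
proof (rule bounded_borel_annulus)
  have "continuous_on {1..R} (\<lambda>s. integral {1..s} (\<lambda>t. (g_lam R \<omega> lam t)\<^sup>2 / t))"
    by (intro indefinite_integral_continuous_1 integrable_continuous_interval continuous_g_lam)
  then show "continuous_on (cannulus R) (radial_pressure R \<omega> lam)"
    unfolding radial_pressure_def[abs_def]
    by (rule continuous_on_compose2) (auto simp: cannulus_def intro!: continuous_intros)
qed

text \<open>The formulas for the angle through arctan are used only off the axes; this makes the
  exceptional set negligible.\<close>

lemma AE_off_axes: "AE x in lebesgue_on \<Omega>. fst (x::pt) \<noteq> 0 \<and> snd x \<noteq> 0" if "\<Omega> \<in> sets borel" for \<Omega>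
proof -
  have "negligible {x::pt. x \<bullet> (1,0) = 0}" "negligible {x::pt. x \<bullet> (0,1) = 0}"
    by (intro negligible_standard_hyperplane; simp add: Basis_pt)+
  then have "AE x in lebesgue. x \<notin> {x::pt. x \<bullet> (1,0) = 0}" "AE x in lebesgue. x \<notin> {x::pt. x \<bullet> (0,1) = 0}"
    by (simp_all only: negligible_iff_null_sets AE_not_in)
  then have "AE x in lebesgue. x \<in> \<Omega> \<longrightarrow> fst (x::pt) \<noteq> 0 \<and> snd x \<noteq> 0"
    by eventually_elim (simp add: inner_prod_def)
  then show ?thesis using AE_restrict_space_iff[of \<Omega> lebesgue] that by fastforce
qed


section \<open>The weak formulation\<close>

text \<open>Here vei is the derivative of the e-th component of v in direction i.\<close>
definition v11 :: "real \<Rightarrow> real \<Rightarrow> pt \<Rightarrow> real" where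
  "v11 A lam x = - fst x * snd x * mf A lam x"
definition v12 :: "real \<Rightarrow> real \<Rightarrow> pt \<Rightarrow> real" where
  "v12 A lam x = - kf A lam x - (snd x)\<^sup>2 * mf A lam x"
definition v21 :: "real \<Rightarrow> real \<Rightarrow> pt \<Rightarrow> real" where
  "v21 A lam x = kf A lam x + (fst x)\<^sup>2 * mf A lam x"
definition v22 :: "real \<Rightarrow> real \<Rightarrow> pt \<Rightarrow> real" where
  "v22 A lam x = fst x * snd x * mf A lam x"

lemma bounded_borel_kmn:
  "bounded_borel (annulus R) (kf A lam)" "bounded_borel (annulus R) (mf A lam)" "bounded_borel (annulus R) (nf A lam)"
  "bounded_borel (annulus R) (\<lambda>x. inverse (rsq x))" "bounded_borel (annulus R) fst" "bounded_borel (annulus R) snd"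
  by (intro bounded_borel_annulus continuous_kmn continuous_intros)+

lemma bounded_borel_uminus: "bounded_borel \<Omega> u \<Longrightarrow> bounded_borel \<Omega> (\<lambda>x. - u x)"
  unfolding bounded_borel_def by simp

lemma bounded_borel_diff: "bounded_borel \<Omega> u \<Longrightarrow> bounded_borel \<Omega> v \<Longrightarrow> bounded_borel \<Omega> (\<lambda>x. u x - v x)"
  using bounded_borel_add[OF _ bounded_borel_uminus] by fastforce

lemma bounded_borel_power: "\<Omega> \<in> sets borel \<Longrightarrow> bounded_borel \<Omega> u \<Longrightarrow> bounded_borel \<Omega> (\<lambda>x. u x ^ n)"
  by (induction n) (simp_all add: bounded_borel_const bounded_borel_mult)

lemma bounded_borel_cong: "bounded_borel \<Omega> u \<Longrightarrow> (\<And>x. x \<in> \<Omega> \<Longrightarrow> u x = v x) \<Longrightarrow> bounded_borel \<Omega> v"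
proof -
  assume u: "bounded_borel \<Omega> u" and e: "\<And>x. x \<in> \<Omega> \<Longrightarrow> u x = v x"
  have "(\<lambda>x. indicator \<Omega> x * u x) = (\<lambda>x. indicator \<Omega> x * v x)" using e by (auto simp: indicator_def)
  then show ?thesis using u e unfolding bounded_borel_def by auto
qed

lemmas bounded_borel_intros = bounded_borel_uminus bounded_borel_diff bounded_borel_add bounded_borel_mult bounded_borel_power[OF annulus_props(3)]
  bounded_borel_const[OF annulus_props(3)] bounded_borel_kmn

lemma bounded_borel_v: "bounded_borel (annulus R) (v11 A lam)" "bounded_borel (annulus R) (v12 A lam)"
  "bounded_borel (annulus R) (v21 A lam)" "bounded_borel (annulus R) (v22 A lam)"
  unfolding v11_def[abs_def] v12_def[abs_def] v21_def[abs_def] v22_def[abs_def]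
  by (intro bounded_borel_intros)+

lemma has_grad_v_lam:
  fixes R \<omega> lam :: real
  defines "A \<equiv> Acoef R \<omega> lam"
  shows "has_grad (annulus R) (\<lambda>x. v_lam R \<omega> lam x \<bullet> (1,0)) (v11 A lam) (v12 A lam)"
    "has_grad (annulus R) (\<lambda>x. v_lam R \<omega> lam x \<bullet> (0,1)) (v21 A lam) (v22 A lam)"
proof -
  have nz: "x \<noteq> 0" if "x \<in> annulus R" for x using that annulus_subset(2) by blast
  note e = v_lam_eq[OF nz] A_def v11_def v12_def v21_def v22_def inner_prod_def
  show "has_grad (annulus R) (\<lambda>x. v_lam R \<omega> lam x \<bullet> (1,0)) (v11 A lam) (v12 A lam)"
    by (rule has_grad_cong[OF has_grad_subset[OF has_grad_v1[of A lam] annulus_subset(2)] annulus_props(1)])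
      (simp_all add: e)
  show "has_grad (annulus R) (\<lambda>x. v_lam R \<omega> lam x \<bullet> (0,1)) (v21 A lam) (v22 A lam)"
    by (rule has_grad_cong[OF has_grad_subset[OF has_grad_v2[of A lam] annulus_subset(2)] annulus_props(1)])
      (simp_all add: e)
qed

lemma bounded_borel_v_lam: "bounded_borel (annulus R) (\<lambda>x. v_lam R \<omega> lam x \<bullet> (1,0))" "bounded_borel (annulus R) (\<lambda>x. v_lam R \<omega> lam x \<bullet> (0,1))"
proof -
  let ?A = "Acoef R \<omega> lam"
  have b: "bounded_borel (annulus R) (\<lambda>x. - snd x * kf ?A lam x)" "bounded_borel (annulus R) (\<lambda>x. fst x * kf ?A lam x)"
    by (intro bounded_borel_intros)+
  have nz: "x \<noteq> 0" if "x \<in> annulus R" for x using that annulus_subset(2) by blast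
  show "bounded_borel (annulus R) (\<lambda>x. v_lam R \<omega> lam x \<bullet> (1,0))"
    by (rule bounded_borel_cong[OF b(1)]) (simp add: v_lam_eq[OF nz] inner_prod_def)
  show "bounded_borel (annulus R) (\<lambda>x. v_lam R \<omega> lam x \<bullet> (0,1))"
    by (rule bounded_borel_cong[OF b(2)]) (simp add: v_lam_eq[OF nz] inner_prod_def)
qed

lemma H1v_v_lam: "H1v (annulus R) (v_lam R \<omega> lam)"
  using H1_classical(1)[OF annulus_props(1,2) bounded_borel_v_lam(1) bounded_borel_v(1,2) has_grad_v_lam(1)]
    H1_classical(1)[OF annulus_props(1,2) bounded_borel_v_lam(2) bounded_borel_v(3,4) has_grad_v_lam(2)]
  by (auto simp: H1v_def Basis_pt)

lemma wgrad_v_lam: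
  fixes R \<omega> lam :: real
  defines "A \<equiv> Acoef R \<omega> lam" and "w \<equiv> wgrad (annulus R) (v_lam R \<omega> lam)"
  shows "AE x in lebesgue_on (annulus R). w (1,0) (1,0) x = v11 A lam x \<and> w (1,0) (0,1) x = v12 A lam x
    \<and> w (0,1) (1,0) x = v21 A lam x \<and> w (0,1) (0,1) x = v22 A lam x"
  using H1_classical(2,3)[OF annulus_props(1,2) bounded_borel_v_lam(1) bounded_borel_v(1,2) has_grad_v_lam(1)]
    H1_classical(2,3)[OF annulus_props(1,2) bounded_borel_v_lam(2) bounded_borel_v(3,4) has_grad_v_lam(2)]
  unfolding w_def wgrad_def A_def by eventually_elim simp

lemma div_free_v_lam: "div_free (annulus R) (v_lam R \<omega> lam)"
  unfolding div_free_def sum_Basis_pt using wgrad_v_lam[of R \<omega> lam]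
  by eventually_elim (simp add: v11_def v22_def)

text \<open>The field is its own approximating sequence. What has to be checked is that its
  classical derivatives agree almost everywhere with the weak gradient picked by choice.\<close>

lemma h1_approx_v_lam: "h1_approx (annulus R) (\<lambda>_. v_lam R \<omega> lam) (v_lam R \<omega> lam)"
proof -
  let ?v = "v_lam R \<omega> lam" and ?A = "Acoef R \<omega> lam"
  have d: "?v differentiable (at x)" if "x \<in> annulus R" for x
  proof -
    obtain U where "closure (annulus R) \<subseteq> U" "smooth_on U ?v"
      using smooth_v_lam unfolding smooth_up_to_closure_def by blast
    then show ?thesis using smooth_onD(1) that closure_subset by blast
  qed
  have fd: "frechet_derivative ?v (at x) i \<bullet> (1,0) = v11 ?A lam x * fst i + v12 ?A lam x * snd i"
    "frechet_derivative ?v (at x) i \<bullet> (0,1) = v21 ?A lam x * fst i + v22 ?A lam x * snd i"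
    if "x \<in> annulus R" for x i
    unfolding frechet_derivative_inner[OF d[OF that], symmetric]
    using frechet_derivative_at[OF has_gradD[OF has_grad_v_lam(1) that], symmetric]
      frechet_derivative_at[OF has_gradD[OF has_grad_v_lam(2) that], symmetric]
    by (auto dest: fun_cong)
  have "AE x in lebesgue_on (annulus R). \<forall>e\<in>Basis. \<forall>i\<in>Basis.
      frechet_derivative ?v (at x) i \<bullet> e = wgrad (annulus R) ?v e i x"
    using wgrad_v_lam[of R \<omega> lam] AE_space
    by eventually_elim (simp add: Basis_pt fd)
  then have "(LINT x|lebesgue_on (annulus R). (frechet_derivative ?v (at x) i \<bullet> e - wgrad (annulus R) ?v e i x)\<^sup>2) = 0"
    if "e \<in> Basis" "i \<in> Basis" for e i
    by (intro integral_eq_zero_AE) (use that in \<open>auto elim: eventually_mono\<close>)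
  then show ?thesis unfolding h1_approx_def using H1v_v_lam by simp
qed

section \<open>Boundary values and traces\<close>

lemma g_lam_1: "g_lam R \<omega> lam 1 = 0" by (simp add: g_lam_def)

lemma g_lam_R: "R > 1 \<Longrightarrow> g_lam R \<omega> lam R = \<omega>"
proof -
  assume R: "R > 1"
  then have "R\<^sup>2 - 1 \<noteq> 0" by (simp add: power2_eq_1_iff)
  then have "R / (R\<^sup>2 - 1) * (R - 1 / R) = 1" using R by (simp add: field_simps power2_eq_square)
  then have "R / (R\<^sup>2 - 1) * c * (R - 1 / R) = c" for c by (metis mult.commute mult.left_commute mult.right_neutral)
  then show ?thesis by (simp add: g_lam_def)
qed

lemma norm_polar: "r > 0 \<Longrightarrow> norm (r * cos t, r * sin t) = (r::real)"
  by (simp add: norm_Pair power_mult_distrib flip: distrib_left)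

text \<open>Smoothness up to the boundary allows the constant sequence, so the trace is the
  pointwise value on the circle.\<close>

lemma trace_v_lam:
  assumes "r > 0" "\<And>x. norm x = r \<Longrightarrow> g_lam R \<omega> lam r *\<^sub>R theta_hat x = h x"
  shows "trace_circle (annulus R) r (v_lam R \<omega> lam) h"
  unfolding trace_circle_def
proof (intro exI conjI allI)
  show "smooth_up_to_closure (annulus R) (v_lam R \<omega> lam)" by (rule smooth_v_lam)
  show "h1_approx (annulus R) (\<lambda>_. v_lam R \<omega> lam) (v_lam R \<omega> lam)" by (rule h1_approx_v_lam)
  have "v_lam R \<omega> lam (r * cos t, r * sin t) = h (r * cos t, r * sin t)" for t
    using assms(2)[OF norm_polar[OF assms(1)]] by (simp add: v_lam_def norm_polar[OF assms(1)])
  then show "(\<lambda>n. integral {0..2*pi} (\<lambda>t. (norm (v_lam R \<omega> lam (r * cos t, r * sin t) - h (r * cos t, r * sin t)))\<^sup>2)) \<longlonglongrightarrow> 0"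
    by simp
qed

section \<open>The pressure tested against derivatives\<close>

lemma theta_slit: "x \<noteq> 0 \<Longrightarrow> snd x = 0 \<Longrightarrow> theta x = (if fst x \<ge> 0 then 0 else pi)"
proof -
  assume x: "x \<noteq> 0" "snd x = 0"
  then obtain a where a: "x = (a, 0)" "a \<noteq> 0" by (cases x) (auto simp: zero_prod_def)
  then show ?thesis using theta_polar[of a 0] theta_polar[of "-a" pi] by auto
qed

text \<open>The angle is defined by a definite description, so measurability comes from an explicit
  formula: \<open>thetaH\<close> off the horizontal axis, and 0 or pi on it.\<close>

lemma bounded_borel_theta: "bounded_borel (annulus R) theta"
proof -
  define T where "T = (\<lambda>x::pt. if snd x \<noteq> 0 then thetaH x else if fst x \<ge> 0 then 0 else pi)"
  have "T \<in> borel_measurable borel"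
    unfolding T_def thetaH_def borel_prod[symmetric] by measurable
  moreover have "\<bar>T x\<bar> \<le> 2 * pi" for x
    using arctan_bounded[of "fst x / snd x"] pi_gt_zero by (auto simp: T_def thetaH_def)
  ultimately have "bounded_borel (annulus R) T" by (intro bounded_borel_borel annulus_props(3)) blast+
  then show ?thesis
  proof (rule bounded_borel_cong)
    fix x assume "x \<in> annulus R"
    then have "x \<noteq> 0" using annulus_subset(2) by blast
    then show "T x = theta x" using theta_slit[of x] theta_eq_thetaH[of x] by (auto simp: T_def)
  qed
qed

lemma q_lam_eq: "q_lam R \<omega> lam x = radial_pressure R \<omega> lam x - lam * theta x"
  by (simp add: q_lam_def radial_pressure_def)

lemma bounded_borel_q_lam: "bounded_borel (annulus R) (q_lam R \<omega> lam)"
  unfolding q_lam_eq[abs_def] by (intro bounded_borel_intros bounded_borel_radial_pressure bounded_borel_theta)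

definition q1 :: "real \<Rightarrow> real \<Rightarrow> pt \<Rightarrow> real" where
  "q1 A lam x = fst x * (kf A lam x)\<^sup>2 + lam * (snd x * inverse (rsq x))"
definition q2 :: "real \<Rightarrow> real \<Rightarrow> pt \<Rightarrow> real" where
  "q2 A lam x = snd x * (kf A lam x)\<^sup>2 - lam * (fst x * inverse (rsq x))"

lemma bounded_borel_q12: "bounded_borel (annulus R) (q1 A lam)" "bounded_borel (annulus R) (q2 A lam)"
  unfolding q1_def[abs_def] q2_def[abs_def] by (intro bounded_borel_intros)+

lemma integral_cong_bounded_borel:
  assumes "bounded_borel (annulus R) u" "bounded_borel (annulus R) w" "\<And>x. x \<in> annulus R \<Longrightarrow> fst x \<noteq> 0 \<Longrightarrow> snd x \<noteq> 0 \<Longrightarrow> u x = w x"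
  shows "(LINT x|lebesgue_on (annulus R). u x) = (LINT x|lebesgue_on (annulus R). w x)"
proof (rule integral_cong_AE)
  show "AE x in lebesgue_on (annulus R). u x = w x"
    using AE_off_axes[OF annulus_props(3)[of R]] AE_space by eventually_elim (simp add: assms(3))
qed (use bounded_borel_measurable[OF annulus_props(3)] assms in auto)

text \<open>Every horizontal line except y = 0 misses the slit, and on it \<open>thetaH\<close> is a
  differentiable version of the angle; hence no jump term.\<close>

lemma q_lam_parts_1:
  assumes \<phi>: "C1_compact (annulus R) \<phi>"
  shows "(LINT x|lebesgue_on (annulus R). q_lam R \<omega> lam x * frechet_derivative \<phi> (at x) (1,0))
    = - (LINT x|lebesgue_on (annulus R). q1 (Acoef R \<omega> lam) lam x * \<phi> x)"
proof -
  let ?P = "radial_pressure R \<omega> lam"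
  have D: "bounded_borel (annulus R) (\<lambda>x. frechet_derivative \<phi> (at x) (1,0))"
    using bounded_borel_C1_compact(2)[OF \<phi> annulus_props(3)] by (simp add: Basis_pt)
  have b: "bounded_borel (annulus R) (\<lambda>x. ?P x - lam * thetaH x)"
    by (intro bounded_borel_intros bounded_borel_radial_pressure bounded_borel_thetaHV)
  have "(LINT x|lebesgue_on (annulus R). q_lam R \<omega> lam x * frechet_derivative \<phi> (at x) (1,0))
    = (LINT x|lebesgue_on (annulus R). (?P x - lam * thetaH x) * frechet_derivative \<phi> (at x) (1,0))"
    by (rule integral_cong_bounded_borel[OF bounded_borel_mult[OF bounded_borel_q_lam D] bounded_borel_mult[OF b D]]) (simp add: q_lam_eq theta_eq_thetaH)
  also have "\<dots> = - (LINT x|lebesgue_on (annulus R). q1 (Acoef R \<omega> lam) lam x * \<phi> x)"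
  proof (rule integration_by_parts_horizontal[OF annulus_props(1,2) \<phi> b bounded_borel_q12(1)])
    show "AE y in lborel. \<forall>x. (x, y) \<in> annulus R \<longrightarrow>
      ((\<lambda>t. ?P (t, y) - lam * thetaH (t, y)) has_real_derivative q1 (Acoef R \<omega> lam) lam (x, y)) (at x)"
      using AE_lborel_singleton[of 0]
    proof eventually_elim
      case (elim y)
      show ?case
        using DERIV_diff[OF has_grad_lines(1)[OF has_grad_radial_pressure] DERIV_cmult[OF thetaH_deriv[OF elim]]]
        by (simp add: q1_def)
    qed
  qed
  finally show ?thesis .
qed

text \<open>Vertical lines do cross the slit. Replacing the angle by \<open>thetaV\<close> plus 2 pi
  on the quadrant below the slit splits off a differentiable part, and \<open>integral_jump\<close>
  evaluates the rest.\<close>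

lemma q_lam_parts_2:
  assumes \<phi>: "C1_compact (annulus R) \<phi>"
  shows "(LINT x|lebesgue_on (annulus R). q_lam R \<omega> lam x * frechet_derivative \<phi> (at x) (0,1))
    = - (LINT x|lebesgue_on (annulus R). q2 (Acoef R \<omega> lam) lam x * \<phi> x)
      - 2 * pi * lam * integral {1..R} (\<lambda>x. \<phi> (x, 0))"
proof -
  let ?P = "radial_pressure R \<omega> lam" and ?J = "\<lambda>x::pt. of_bool (fst x > 0 \<and> snd x < 0) :: real"
  let ?D = "\<lambda>x. frechet_derivative \<phi> (at x) (0,1)"
  have D: "bounded_borel (annulus R) ?D"
    using bounded_borel_C1_compact(2)[OF \<phi> annulus_props(3)] by (simp add: Basis_pt)
  have b: "bounded_borel (annulus R) (\<lambda>x. ?P x - lam * thetaV x)"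
    by (intro bounded_borel_intros bounded_borel_radial_pressure bounded_borel_thetaHV)
  have J: "bounded_borel (annulus R) ?J"
    by (rule bounded_borel_borel[OF annulus_props(3)]) (auto intro!: exI[of _ 1] simp: borel_prod[symmetric])
  have "(LINT x|lebesgue_on (annulus R). q_lam R \<omega> lam x * ?D x)
    = (LINT x|lebesgue_on (annulus R). (?P x - lam * thetaV x) * ?D x - (2 * pi * lam) * (?J x * ?D x))"
    by (rule integral_cong_bounded_borel[OF bounded_borel_mult[OF bounded_borel_q_lam D]
          bounded_borel_diff[OF bounded_borel_mult[OF b D] bounded_borel_mult[OF bounded_borel_const[OF annulus_props(3)] bounded_borel_mult[OF J D]]]])
      (simp add: q_lam_eq theta_eq_thetaV algebra_simps)
  also have "\<dots> = (LINT x|lebesgue_on (annulus R). (?P x - lam * thetaV x) * ?D x)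
      - (2 * pi * lam) * (LINT x|lebesgue_on (annulus R). ?J x * ?D x)"
    using bounded_borel_integrable[OF annulus_props(2,3) bounded_borel_mult[OF b D]] bounded_borel_integrable[OF annulus_props(2,3) bounded_borel_mult[OF J D]]
    by simp
  also have "(LINT x|lebesgue_on (annulus R). ?J x * ?D x) = integral {1..R} (\<lambda>x. \<phi> (x, 0))"
    by (rule integral_jump[OF \<phi>])
  also have "(LINT x|lebesgue_on (annulus R). (?P x - lam * thetaV x) * ?D x)
      = - (LINT x|lebesgue_on (annulus R). q2 (Acoef R \<omega> lam) lam x * \<phi> x)"
  proof (rule integration_by_parts_vertical[OF annulus_props(1,2) \<phi> b bounded_borel_q12(2)])
    show "AE x in lborel. \<forall>y. (x, y) \<in> annulus R \<longrightarrow>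
      ((\<lambda>t. ?P (x, t) - lam * thetaV (x, t)) has_real_derivative q2 (Acoef R \<omega> lam) lam (x, y)) (at y)"
      using AE_lborel_singleton[of 0]
    proof eventually_elim
      case (elim x)
      show ?case
        using DERIV_diff[OF has_grad_lines(2)[OF has_grad_radial_pressure] DERIV_cmult[OF thetaV_deriv[OF elim]]]
        by (simp add: q2_def)
    qed
  qed
  finally show ?thesis .
qed

text \<open>One momentum component in integrated form: \<open>a\<close> and \<open>b\<close> will be
  the two second derivatives of the velocity component, \<open>c\<close> the convective term and
  \<open>d\<close> the pressure derivative.\<close>

lemma integral_combination:
  assumes \<phi>: "C1_compact (annulus R) \<phi>" and b: "bounded_borel (annulus R) a" "bounded_borel (annulus R) b" "bounded_borel (annulus R) c" "bounded_borel (annulus R) d"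
    and e: "\<And>x. x \<in> annulus R \<Longrightarrow> c x + d x = a x + b x"
  shows "- (LINT x|lebesgue_on (annulus R). a x * \<phi> x) - (LINT x|lebesgue_on (annulus R). b x * \<phi> x)
    + (LINT x|lebesgue_on (annulus R). c x * \<phi> x) + (LINT x|lebesgue_on (annulus R). d x * \<phi> x) = 0"
proof -
  note i = bounded_borel_integrable[OF annulus_props(2,3) bounded_borel_mult[OF _ bounded_borel_C1_compact(1)[OF \<phi> annulus_props(3)]]]
  have "(LINT x|lebesgue_on (annulus R). a x * \<phi> x) + (LINT x|lebesgue_on (annulus R). b x * \<phi> x)
      = (LINT x|lebesgue_on (annulus R). a x * \<phi> x + b x * \<phi> x)"
    using i[OF b(1)] i[OF b(2)] by simp
  also have "\<dots> = (LINT x|lebesgue_on (annulus R). c x * \<phi> x + d x * \<phi> x)"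
    by (rule Bochner_Integration.integral_cong) (simp_all add: e flip: distrib_right)
  also have "\<dots> = (LINT x|lebesgue_on (annulus R). c x * \<phi> x) + (LINT x|lebesgue_on (annulus R). d x * \<phi> x)"
    using i[OF b(3)] i[OF b(4)] by simp
  finally show ?thesis by simp
qed

text \<open>The convective term is already simplified to -k^2 (x, y). After integration by parts
  each momentum component cancels pointwise, so the right-hand side is exactly the jump term of
  \<open>q_lam_parts_2\<close>.\<close>

lemma weak_form_test:
  fixes R \<omega> lam :: real
  defines "A \<equiv> Acoef R \<omega> lam" and "I \<equiv> \<lambda>f. LINT x|lebesgue_on (annulus R). f x"
  assumes \<phi>: "C1_compact (annulus R) \<phi>1" "C1_compact (annulus R) \<phi>2"
  shows "I (\<lambda>x. v11 A lam x * frechet_derivative \<phi>1 (at x) (1,0)) + I (\<lambda>x. v12 A lam x * frechet_derivative \<phi>1 (at x) (0,1))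
    + I (\<lambda>x. v21 A lam x * frechet_derivative \<phi>2 (at x) (1,0)) + I (\<lambda>x. v22 A lam x * frechet_derivative \<phi>2 (at x) (0,1))
    + I (\<lambda>x. - (fst x * (kf A lam x)\<^sup>2) * \<phi>1 x) + I (\<lambda>x. - (snd x * (kf A lam x)\<^sup>2) * \<phi>2 x)
    - I (\<lambda>x. q_lam R \<omega> lam x * frechet_derivative \<phi>1 (at x) (1,0)) - I (\<lambda>x. q_lam R \<omega> lam x * frechet_derivative \<phi>2 (at x) (0,1))
    = 2 * pi * lam * integral {1..R} (\<lambda>x. \<phi>2 (x, 0))"
proof -
  have g: "has_grad (annulus R) u u1 u2" if "has_grad (-{0}) u u1 u2" for u u1 u2
    using has_grad_subset[OF that annulus_subset(2)] .
  note p = integration_by_parts_grad[OF annulus_props(1,2)]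
  let ?m = "mf A lam" and ?n = "nf A lam"
  have 1: "I (\<lambda>x. v11 A lam x * frechet_derivative \<phi>1 (at x) (1,0)) =
      - I (\<lambda>x. (- snd x * ?m x - (fst x)\<^sup>2 * snd x * ?n x) * \<phi>1 x)"
    unfolding I_def
    by (rule p(1)[OF \<phi>(1) bounded_borel_v(1) _ _ g[OF has_grad_v11[folded v11_def]]]; intro bounded_borel_intros)
  have 2: "I (\<lambda>x. v12 A lam x * frechet_derivative \<phi>1 (at x) (0,1)) =
      - I (\<lambda>x. (- 3 * snd x * ?m x - (snd x)^3 * ?n x) * \<phi>1 x)"
    unfolding I_def
    by (rule p(2)[OF \<phi>(1) bounded_borel_v(2) _ _ g[OF has_grad_v12[folded v12_def]]]; intro bounded_borel_intros)
  have 3: "I (\<lambda>x. v21 A lam x * frechet_derivative \<phi>2 (at x) (1,0)) =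
      - I (\<lambda>x. (3 * fst x * ?m x + (fst x)^3 * ?n x) * \<phi>2 x)"
    unfolding I_def
    by (rule p(1)[OF \<phi>(2) bounded_borel_v(3) _ _ g[OF has_grad_v21[folded v21_def]]]; intro bounded_borel_intros)
  have 4: "I (\<lambda>x. v22 A lam x * frechet_derivative \<phi>2 (at x) (0,1)) =
      - I (\<lambda>x. (fst x * ?m x + fst x * (snd x)\<^sup>2 * ?n x) * \<phi>2 x)"
    unfolding I_def
    by (rule p(2)[OF \<phi>(2) bounded_borel_v(4) _ _ g[OF has_grad_xym[folded v22_def]]]; intro bounded_borel_intros)
  have id: "4 * ?m x + ((fst x)\<^sup>2 + (snd x)\<^sup>2) * ?n x = - lam * inverse (rsq x)" if "x \<in> annulus R" for x
    using kmn_identity[of x A lam] annulus_subset(2)[of R] that by (auto simp: rsq_def)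
  have z1: "- I (\<lambda>x. (- snd x * ?m x - (fst x)\<^sup>2 * snd x * ?n x) * \<phi>1 x) - I (\<lambda>x. (- 3 * snd x * ?m x - (snd x)^3 * ?n x) * \<phi>1 x)
    + I (\<lambda>x. - (fst x * (kf A lam x)\<^sup>2) * \<phi>1 x) + I (\<lambda>x. q1 A lam x * \<phi>1 x) = 0"
    unfolding I_def
  proof (rule integral_combination[OF \<phi>(1)])
    fix x assume "x \<in> annulus R"
    \<comment> \<open>The k^2 terms cancel against the radial pressure; what remains is
      \<open>id\<close> multiplied by -y. The second component below uses \<open>id\<close>
      multiplied by x.\<close>
    from id[OF this] show "- (fst x * (kf A lam x)\<^sup>2) + q1 A lam x =
        - snd x * ?m x - (fst x)\<^sup>2 * snd x * ?n x + (- 3 * snd x * ?m x - (snd x)^3 * ?n x)"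
      unfolding q1_def by algebra
  qed (intro bounded_borel_intros bounded_borel_q12)+
  have z2: "- I (\<lambda>x. (3 * fst x * ?m x + (fst x)^3 * ?n x) * \<phi>2 x) - I (\<lambda>x. (fst x * ?m x + fst x * (snd x)\<^sup>2 * ?n x) * \<phi>2 x)
    + I (\<lambda>x. - (snd x * (kf A lam x)\<^sup>2) * \<phi>2 x) + I (\<lambda>x. q2 A lam x * \<phi>2 x) = 0"
    unfolding I_def
  proof (rule integral_combination[OF \<phi>(2)])
    fix x assume "x \<in> annulus R"
    from id[OF this] show "- (snd x * (kf A lam x)\<^sup>2) + q2 A lam x =
        3 * fst x * ?m x + (fst x)^3 * ?n x + (fst x * ?m x + fst x * (snd x)\<^sup>2 * ?n x)"
      unfolding q2_def by algebra
  qed (intro bounded_borel_intros bounded_borel_q12)+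
  show ?thesis
    using 1 2 3 4 z1 z2 q_lam_parts_1[OF \<phi>(1), of \<omega> lam] q_lam_parts_2[OF \<phi>(2), of \<omega> lam]
    unfolding A_def[symmetric] I_def by linarith
qed


lemma is_pressure_q_lam: "is_pressure R (v_lam R \<omega> lam) (q_lam R \<omega> lam)"
  unfolding is_pressure_def
proof (intro allI impI)
  fix \<phi> assume HH: "HH R \<phi>"
  define A where "A = Acoef R \<omega> lam"
  define v where "v = v_lam R \<omega> lam"
  define q where "q = q_lam R \<omega> lam"
  let ?M = "lebesgue_on (annulus R)"
  let ?k = "kf A lam"
  define w where "w = wgrad (annulus R) \<phi>"
  define I where "I = (\<lambda>f. LINT x|?M. (f x :: real))"
  \<comment> \<open>The sequence is the one witnessing \<open>zero_flux_Sigma\<close>: the same test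
    fields must converge to phi and have fluxes tending to zero.\<close>
  obtain \<psi> where test: "\<And>n. test_fun (annulus R) (\<psi> n)" and app: "h1_approx (annulus R) \<psi> \<phi>"
    and flux: "(\<lambda>n. integral {1..R} (\<lambda>x. \<psi> n (x, 0) \<bullet> (0, 1))) \<longlonglongrightarrow> 0"
    using HH unfolding HH_def zero_flux_Sigma_def by blast
  have H: "H1 (annulus R) (\<lambda>x. \<phi> x \<bullet> e)" if "e \<in> Basis" for e
    using app that unfolding h1_approx_def H1v_def by blast
  have e12: "(1,0) \<in> (Basis::pt set)" "(0,1) \<in> (Basis::pt set)" by (auto simp: Basis_pt)
  have L\<phi>: "L2 (annulus R) (\<lambda>x. \<phi> x \<bullet> e)" if "e \<in> Basis" for e
    using H[OF that] by (simp add: H1_def)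
  have Lw: "L2 (annulus R) (w e i)" if "e \<in> Basis" "i \<in> Basis" for e i
    unfolding w_def wgrad_def using wd_L2(1)[OF H[OF that(1)] that(2)] .
  define p where "p = (\<lambda>n e x. \<psi> n x \<bullet> e)"
  have C: "C1_compact (annulus R) (p n e)" for n e
    unfolding p_def by (rule test_fun_C1_compact[OF test])
  \<comment> \<open>The approximation is stated with components of the vector derivative,
    integration by parts with derivatives of the scalar components.\<close>
  have fd: "frechet_derivative (\<psi> n) (at x) i \<bullet> e = frechet_derivative (p n e) (at x) i" for n x i e
  proof -
    have "smooth_on UNIV (\<psi> n)" using test[of n] unfolding test_fun_def by blast
    from smooth_onD(1)[OF this UNIV_I] show ?thesis
      unfolding p_def by (rule frechet_derivative_inner[symmetric])
  qed
  have L: "L2 (annulus R) (p n e)" "i \<in> Basis \<Longrightarrow> L2 (annulus R) (\<lambda>x. frechet_derivative (p n e) (at x) i)" for n e i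
    by (intro bounded_borel_L2[OF annulus_props(2,3)] bounded_borel_C1_compact[OF C annulus_props(3)]; assumption)+
  have lim0: "(\<lambda>n. I (\<lambda>x. u x * p n e x)) \<longlonglongrightarrow> I (\<lambda>x. u x * (\<phi> x \<bullet> e))"
    if "bounded_borel (annulus R) u" "e \<in> Basis" for u e
    unfolding I_def
  proof (rule L2_limit[OF annulus_props(2,3) that(1) L(1) L\<phi>[OF that(2)]])
    show "(\<lambda>n. LINT x|?M. (p n e x - \<phi> x \<bullet> e)\<^sup>2) \<longlonglongrightarrow> 0"
      using app that(2) unfolding h1_approx_def p_def by blast
  qed
  have lim1: "(\<lambda>n. I (\<lambda>x. u x * frechet_derivative (p n e) (at x) i)) \<longlonglongrightarrow> I (\<lambda>x. u x * w e i x)"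
    if "bounded_borel (annulus R) u" "e \<in> Basis" "i \<in> Basis" for u e i
    unfolding I_def
  proof (rule L2_limit[OF annulus_props(2,3) that(1) L(2)[OF that(3)] Lw[OF that(2,3)]])
    show "(\<lambda>n. LINT x|?M. (frechet_derivative (p n e) (at x) i - w e i x)\<^sup>2) \<longlonglongrightarrow> 0"
      using app that(2,3) unfolding h1_approx_def fd w_def by blast
  qed
  have bc: "bounded_borel (annulus R) (\<lambda>x. - (fst x * (?k x)\<^sup>2))" "bounded_borel (annulus R) (\<lambda>x. - (snd x * (?k x)\<^sup>2))"
    by (intro bounded_borel_intros)+
  have bq: "bounded_borel (annulus R) q" unfolding q_def by (rule bounded_borel_q_lam)
  \<comment> \<open>\<open>?E\<close> is the weak form of phi with classical coefficients, and
    \<open>?T n\<close> below is its counterpart for the test field with index n, which equals 2 pi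
    lambda times its flux.\<close>
  let ?E = "I (\<lambda>x. v11 A lam x * w (1,0) (1,0) x) + I (\<lambda>x. v12 A lam x * w (1,0) (0,1) x)
    + I (\<lambda>x. v21 A lam x * w (0,1) (1,0) x) + I (\<lambda>x. v22 A lam x * w (0,1) (0,1) x)
    + I (\<lambda>x. - (fst x * (?k x)\<^sup>2) * (\<phi> x \<bullet> (1,0))) + I (\<lambda>x. - (snd x * (?k x)\<^sup>2) * (\<phi> x \<bullet> (0,1)))
    - I (\<lambda>x. q x * w (1,0) (1,0) x) - I (\<lambda>x. q x * w (0,1) (0,1) x)"
  let ?d = "\<lambda>n e i x. frechet_derivative (p n e) (at x) i"
  let ?T = "\<lambda>n. I (\<lambda>x. v11 A lam x * ?d n (1,0) (1,0) x) + I (\<lambda>x. v12 A lam x * ?d n (1,0) (0,1) x)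
    + I (\<lambda>x. v21 A lam x * ?d n (0,1) (1,0) x) + I (\<lambda>x. v22 A lam x * ?d n (0,1) (0,1) x)
    + I (\<lambda>x. - (fst x * (?k x)\<^sup>2) * p n (1,0) x) + I (\<lambda>x. - (snd x * (?k x)\<^sup>2) * p n (0,1) x)
    - I (\<lambda>x. q x * ?d n (1,0) (1,0) x) - I (\<lambda>x. q x * ?d n (0,1) (0,1) x)"
  have "?T n = 2 * pi * lam * integral {1..R} (\<lambda>x. p n (0,1) (x, 0))" for n
    unfolding I_def A_def q_def by (rule weak_form_test[OF C C])
  moreover have "?T \<longlonglongrightarrow> ?E"
    by (intro tendsto_add tendsto_diff lim0 lim1 bounded_borel_v bc bq e12)
  ultimately have "(\<lambda>n. 2 * pi * lam * integral {1..R} (\<lambda>x. p n (0,1) (x, 0))) \<longlonglongrightarrow> ?E"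
    by simp
  moreover have "(\<lambda>n. 2 * pi * lam * integral {1..R} (\<lambda>x. p n (0,1) (x, 0))) \<longlonglongrightarrow> 2 * pi * lam * 0"
    unfolding p_def by (intro tendsto_intros flux)
  ultimately have E: "?E = 0" using LIMSEQ_unique by fastforce
  have vx: "v x = (- snd x * ?k x, fst x * ?k x)" if "x \<in> annulus R" for x
    unfolding v_def A_def by (rule v_lam_eq) (use that annulus_subset(2) in blast)
  have Hv: "H1 (annulus R) (\<lambda>x. v x \<bullet> e)" if "e \<in> Basis" for e
    using H1v_v_lam that unfolding v_def H1v_def by blast
  have bv: "bounded_borel (annulus R) (\<lambda>x. v x \<bullet> e)" if "e \<in> Basis" for e
    using bounded_borel_v_lam that unfolding v_def Basis_pt by auto
  have Lwv: "L2 (annulus R) (wgrad (annulus R) v e i)" if "e \<in> Basis" "i \<in> Basis" for e i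
    unfolding wgrad_def using wd_L2(1)[OF Hv[OF that(1)] that(2)] .
  have mL: "f \<in> borel_measurable ?M" if "L2 (annulus R) f" for f using that by (simp add: L2_def)
  note mb = bounded_borel_measurable[OF annulus_props(3)]
  have int: "integrable ?M (\<lambda>x. u x * f x)" if "bounded_borel (annulus R) u" "L2 (annulus R) f" for u f
    by (rule bounded_borel_L2_integrable[OF annulus_props(2,3) that])
  note wv = wgrad_v_lam[of R \<omega> lam, folded v_def A_def]
  \<comment> \<open>The gradients of v inside \<open>dirichlet\<close> are chosen ones; they may be
    replaced by the classical ones under the integral, their measurability coming from membership in
    \<open>L2\<close>.\<close>
  have D: "dirichlet R v \<phi> = I (\<lambda>x. v11 A lam x * w (1,0) (1,0) x) + I (\<lambda>x. v12 A lam x * w (1,0) (0,1) x)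
    + I (\<lambda>x. v21 A lam x * w (0,1) (1,0) x) + I (\<lambda>x. v22 A lam x * w (0,1) (0,1) x)"
  proof -
    have "dirichlet R v \<phi> = I (\<lambda>x. (v11 A lam x * w (1,0) (1,0) x + v12 A lam x * w (1,0) (0,1) x)
        + (v21 A lam x * w (0,1) (1,0) x + v22 A lam x * w (0,1) (0,1) x))"
      unfolding dirichlet_def sum_Basis_pt I_def w_def[symmetric]
    proof (rule integral_cong_AE)
      show "AE x in ?M. wgrad (annulus R) v (1,0) (1,0) x * w (1,0) (1,0) x + wgrad (annulus R) v (1,0) (0,1) x * w (1,0) (0,1) x
        + (wgrad (annulus R) v (0,1) (1,0) x * w (0,1) (1,0) x + wgrad (annulus R) v (0,1) (0,1) x * w (0,1) (0,1) x)
        = v11 A lam x * w (1,0) (1,0) x + v12 A lam x * w (1,0) (0,1) x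
        + (v21 A lam x * w (0,1) (1,0) x + v22 A lam x * w (0,1) (0,1) x)"
        using wv by eventually_elim simp
    qed (intro borel_measurable_add borel_measurable_times mL Lwv Lw e12 mb bounded_borel_v)+
    then show ?thesis unfolding I_def
      by (simp add: int bounded_borel_v Lw e12)
  qed
  have Cv: "convective R v \<phi> = I (\<lambda>x. - (fst x * (?k x)\<^sup>2) * (\<phi> x \<bullet> (1,0))) + I (\<lambda>x. - (snd x * (?k x)\<^sup>2) * (\<phi> x \<bullet> (0,1)))"
  proof -
    have "convective R v \<phi> = I (\<lambda>x. - (fst x * (?k x)\<^sup>2) * (\<phi> x \<bullet> (1,0)) + - (snd x * (?k x)\<^sup>2) * (\<phi> x \<bullet> (0,1)))"
      unfolding convective_def sum_Basis_pt I_def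
    proof (rule integral_cong_AE)
      show "AE x in ?M. v x \<bullet> (1,0) * wgrad (annulus R) v (1,0) (1,0) x * (\<phi> x \<bullet> (1,0))
          + v x \<bullet> (0,1) * wgrad (annulus R) v (1,0) (0,1) x * (\<phi> x \<bullet> (1,0))
          + (v x \<bullet> (1,0) * wgrad (annulus R) v (0,1) (1,0) x * (\<phi> x \<bullet> (0,1))
          + v x \<bullet> (0,1) * wgrad (annulus R) v (0,1) (0,1) x * (\<phi> x \<bullet> (0,1)))
        = - (fst x * (?k x)\<^sup>2) * (\<phi> x \<bullet> (1,0)) + - (snd x * (?k x)\<^sup>2) * (\<phi> x \<bullet> (0,1))"
        using wv AE_space
      proof eventually_elim
        case (elim x)
        then have "v x \<bullet> (1,0) = - snd x * ?k x" "v x \<bullet> (0,1) = fst x * ?k x"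
          using vx[of x] by (simp_all add: inner_prod_def)
        \<comment> \<open>The derivative along (-y, x) annihilates radial factors, so the terms with
          \<open>mf\<close> cancel and only the centripetal acceleration remains.\<close>
        moreover have "- snd x * ?k x * v11 A lam x + fst x * ?k x * v12 A lam x = - (fst x * (?k x)\<^sup>2)"
          "- snd x * ?k x * v21 A lam x + fst x * ?k x * v22 A lam x = - (snd x * (?k x)\<^sup>2)"
          unfolding v11_def v12_def v21_def v22_def by algebra+
        ultimately show ?case using elim(1)
          by (metis (no_types, lifting) distrib_right)
      qed
    qed (intro borel_measurable_add borel_measurable_times mL Lwv L\<phi> e12 mb bv bc)+
    then show ?thesis unfolding I_def
      using int[OF bc(1) L\<phi>[OF e12(1)]] int[OF bc(2) L\<phi>[OF e12(2)]] by simp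
  qed
  have P: "pressure_term R q \<phi> = I (\<lambda>x. q x * w (1,0) (1,0) x) + I (\<lambda>x. q x * w (0,1) (0,1) x)"
    unfolding pressure_term_def sum_Basis_pt I_def w_def[symmetric] distrib_left
    by (rule Bochner_Integration.integral_add) (intro int bq Lw e12)+
  show "dirichlet R v \<phi> + convective R v \<phi> - pressure_term R q \<phi> = 0"
    using E D Cv P by linarith
qed

text \<open>The weak equation is the pressure identity restricted to fields whose weak divergence
  vanishes almost everywhere, for which the pressure term is zero.\<close>

lemma incomplete_solution_v_lam:
  assumes "R > 1"
  shows "incomplete_solution R \<omega> (\<lambda>_. 0) (v_lam R \<omega> lam)"
  unfolding incomplete_solution_def H1star_sigma_def
proof (intro conjI allI impI)
  show "H1v (annulus R) (v_lam R \<omega> lam)" by (rule H1v_v_lam)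
  show "trace_circle (annulus R) 1 (v_lam R \<omega> lam) (\<lambda>_. 0)"
    by (rule trace_v_lam) (simp_all add: g_lam_1)
  show "div_free (annulus R) (v_lam R \<omega> lam)" by (rule div_free_v_lam)
  show "trace_circle (annulus R) R (v_lam R \<omega> lam) (\<lambda>\<xi>. \<omega> *\<^sub>R theta_hat \<xi>)"
    by (rule trace_v_lam) (use assms in \<open>simp_all add: g_lam_R\<close>)
  fix \<phi> assume \<phi>: "HH_sigma R \<phi>"
  have "pressure_term R (q_lam R \<omega> lam) \<phi> = 0"
    unfolding pressure_term_def
    by (rule integral_eq_zero_AE) (use \<phi> in \<open>auto simp: HH_sigma_def div_free_def elim!: eventually_mono\<close>)
  then show "dirichlet R (v_lam R \<omega> lam) \<phi> + convective R (v_lam R \<omega> lam) \<phi> = (LINT x|lebesgue_on (annulus R). 0 \<bullet> \<phi> x)"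
    using is_pressure_q_lam \<phi> unfolding is_pressure_def HH_sigma_def by fastforce
qed

section \<open>Distinctness and the discontinuity of the pressure\<close>

lemma has_grad_zero:
  assumes "has_grad U f f1 f2" "open U" "\<And>x. x \<in> U \<Longrightarrow> f x = 0" "x \<in> U"
  shows "f1 x = 0" "f2 x = 0"
proof -
  have "(f has_derivative (\<lambda>_. 0)) (at x)"
    by (rule has_derivative_transform_within_open[OF _ assms(2,4), of "\<lambda>_. 0"]) (auto simp: assms(3))
  from has_derivative_unique[OF this has_gradD[OF assms(1,4)]]
  have e: "0 = f1 x * fst h + f2 x * snd h" for h by metis
  show "f1 x = 0" "f2 x = 0" using e[of "(1,0)"] e[of "(0,1)"] by auto
qed

text \<open>By continuity the set where \<open>f\<close> is nonzero is open; being negligible, it is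
  empty.\<close>

lemma AE_open_imp_everywhere:
  fixes f :: "pt \<Rightarrow> real"
  assumes "open U" "continuous_on U f" "AE x in lebesgue_on U. f x = 0" "x \<in> U"
  shows "f x = 0"
proof -
  let ?S = "{x \<in> U. f x \<noteq> 0}"
  have "?S = f -` (-{0}) \<inter> U" by auto
  then have "open ?S" using continuous_open_preimage[OF assms(2,1), of "-{0}"] open_Compl[OF closed_singleton[of "0::real"]]
    by (simp only: Int_commute)
  moreover have "AE x in lebesgue. x \<notin> ?S"
    using assms(3) AE_restrict_space_iff[of U lebesgue] assms(1) by auto
  then have "negligible ?S" by (simp add: negligible_iff_null_sets AE_iff_null_sets lmeasurable_open \<open>open ?S\<close>)
  ultimately show ?thesis using open_not_negligible assms(4) by blast
qed

text \<open>\<open>kf\<close> is linear in its two parameters, so the difference of two fields is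
  governed by \<open>kf B d\<close>. If that vanishes, so do \<open>mf\<close> and \<open>nf\<close>
  by differentiation, and \<open>kmn_identity\<close> forces d = 0.\<close>

lemma v_lam_distinct:
  assumes R: "R > 1" and ae: "AE \<xi> in lebesgue_on (annulus R). v_lam R \<omega> lam \<xi> = v_lam R \<omega> mu \<xi>"
  shows "lam = mu"
proof -
  define B where "B = Acoef R \<omega> lam - Acoef R \<omega> mu"
  define d where "d = lam - mu"
  have kd: "kf B d x = kf (Acoef R \<omega> lam) lam x - kf (Acoef R \<omega> mu) mu x" for x
    unfolding kf_def B_def d_def by (simp add: field_simps)
  have nz: "x \<noteq> 0" if "x \<in> annulus R" for x using that annulus_subset(2) by blast
  have "AE x in lebesgue_on (annulus R). kf B d x = 0"
    using ae AE_space
  proof eventually_elim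
    case (elim x)
    then have "x \<noteq> 0" using nz by simp
    then show ?case using elim(1) unfolding kd by (cases x) (auto simp: v_lam_eq zero_prod_def)
  qed
  then have k0: "kf B d x = 0" if "x \<in> annulus R" for x
    using AE_open_imp_everywhere[OF annulus_props(1) continuous_on_subset[OF continuous_kmn(1) annulus_subset(1)]] that
    by blast
  have m0: "mf B d x = 0" if "x \<in> annulus R" for x
    using has_grad_zero[OF has_grad_subset[OF has_grad_kf annulus_subset(2)] annulus_props(1) k0 that] nz[OF that]
    by (cases x) (auto simp: zero_prod_def)
  have n0: "nf B d x = 0" if "x \<in> annulus R" for x
    using has_grad_zero[OF has_grad_subset[OF has_grad_mf annulus_subset(2)] annulus_props(1) m0 that] nz[OF that]
    by (cases x) (auto simp: zero_prod_def)
  \<comment> \<open>Any point of the annulus serves to evaluate the identity; this is the midpoint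
    of the slit.\<close>
  have x: "((1 + R) / 2, 0) \<in> annulus R" using R by (simp add: annulus_def norm_Pair)
  have "- d * inverse (rsq ((1 + R) / 2, 0)) = 0"
    using kmn_identity[OF nz[OF x], of B d] m0[OF x] n0[OF x] by simp
  then show ?thesis using rsq_pos[OF nz[OF x]] by (simp add: d_def)
qed

lemma q_lam_discontinuous:
  assumes "lam \<noteq> 0" "1 < x" "x < R"
  shows "\<not> continuous (at (x, 0) within annulus R) (q_lam R \<omega> lam)"
proof
  assume c: "continuous (at (x, 0) within annulus R) (q_lam R \<omega> lam)"
  have x: "x > 0" using assms by simp
  \<comment> \<open>The slit is approached from below along its circle, with the angle increasing to
    2 pi, whereas the angle on the slit itself is 0.\<close>
  let ?p = "\<lambda>t. (x * cos t, x * sin t)" and ?F = "at_left (2 * pi)"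
  define P where "P = integral {1..x} (\<lambda>t. (g_lam R \<omega> lam t)\<^sup>2 / t)"
  have q: "q_lam R \<omega> lam (?p t) = P - lam * t" if "0 \<le> t" "t < 2 * pi" for t
    using theta_polar[OF x that] norm_polar[OF x, of t] by (simp add: q_lam_def P_def)
  have "(?p \<longlongrightarrow> (x * cos (2 * pi), x * sin (2 * pi))) ?F" by (intro tendsto_intros)
  then have p: "(?p \<longlongrightarrow> (x, 0)) ?F" by simp
  have "((\<lambda>t. q_lam R \<omega> lam (?p t)) \<longlongrightarrow> q_lam R \<omega> lam (x, 0)) ?F"
    by (rule continuous_within_tendsto_compose[OF c _ p])
      (use assms in \<open>simp add: annulus_def norm_polar[OF x]\<close>)
  moreover have "((\<lambda>t. q_lam R \<omega> lam (?p t)) \<longlongrightarrow> P - lam * (2 * pi)) ?F"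
  proof (rule Lim_transform_eventually)
    show "((\<lambda>t. P - lam * t) \<longlongrightarrow> P - lam * (2 * pi)) ?F" by (intro tendsto_intros)
    have "eventually (\<lambda>t. t \<in> {0<..<2*pi}) ?F" by (rule eventually_at_left_real) simp
    then show "eventually (\<lambda>t. P - lam * t = q_lam R \<omega> lam (?p t)) ?F"
      by eventually_elim (simp add: q)
  qed
  ultimately have "q_lam R \<omega> lam (x, 0) = P - lam * (2 * pi)"
    using tendsto_unique[of ?F] by (simp add: trivial_limit_at_left_real)
  then show False using q[of 0] assms by simp
qed

text \<open>Subtracting the classical y-derivative from a supposed weak one leaves an integrable
  function that represents the functional 2 pi lambda times the slit integral. Bumps with fixed
  values on the slit and shrinking supports show that this is impossible.\<close>

lemma q_lam_not_H1:
  assumes R: "R > 1" and lam: "lam \<noteq> 0"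
  shows "\<not> H1 (annulus R) (q_lam R \<omega> lam)"
proof
  assume "H1 (annulus R) (q_lam R \<omega> lam)"
  then obtain g where g: "L2 (annulus R) g" and wg: "weak_deriv (annulus R) (q_lam R \<omega> lam) (0,1) g"
    unfolding H1_def by (auto simp: Basis_pt)
  let ?M = "lebesgue_on (annulus R)"
  define Q where "Q = q2 (Acoef R \<omega> lam) lam"
  have bQ: "bounded_borel (annulus R) Q" unfolding Q_def by (rule bounded_borel_q12)
  have h: "integrable ?M (\<lambda>x. g x - Q x)"
    using L2_integrable[OF annulus_props(2,3) g] bounded_borel_integrable[OF annulus_props(2,3) bQ] by simp
  have key: "(LINT x|?M. (g x - Q x) * \<phi> x) = 2 * pi * lam * integral {1..R} (\<lambda>x. \<phi> (x, 0))"
    if "test_fun (annulus R) \<phi>" for \<phi>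
  proof -
    have C: "C1_compact (annulus R) \<phi>" by (rule test_fun_C1_compact_real[OF that])
    have "integrable ?M (\<lambda>x. g x * \<phi> x)" "integrable ?M (\<lambda>x. Q x * \<phi> x)"
      using wg that bounded_borel_integrable[OF annulus_props(2,3) bounded_borel_mult[OF bQ bounded_borel_C1_compact(1)[OF C annulus_props(3)]]]
      unfolding weak_deriv_def by auto
    then show ?thesis
      using wg that q_lam_parts_2[OF C, of \<omega> lam]
      unfolding weak_deriv_def Q_def[symmetric] by (simp add: left_diff_distrib)
  qed
  \<comment> \<open>\<open>a\<close> and \<open>b\<close> cut the interval from 1 to R into thirds.
    With \<open>\<delta>\<close> half the gap beyond \<open>b\<close>, the triangle inequality keeps
    every rectangle used below inside the annulus.\<close>
  define a b \<delta> where "a = (2 + R) / 3" and "b = (1 + 2 * R) / 3" and "\<delta> = (R - b) / 2"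
  have ab: "1 < a" "a < b" "b < R" "\<delta> > 0" "b + \<delta> < R" using R by (auto simp: a_def b_def \<delta>_def field_simps)
  \<comment> \<open>The steepness \<open>Suc n\<close> offsets the height
    \<open>\<delta> / Suc n\<close>: at y = 0 both vertical factors equal
    \<open>bump 0 \<delta>\<close>, independently of n.\<close>
  define \<phi> where "\<phi> = (\<lambda>n. box_bump 1 (Suc n) a b (- (\<delta> / Suc n)) (\<delta> / Suc n))"
  have sub: "{a..b} \<times> {- (\<delta> / Suc n)..\<delta> / Suc n} \<subseteq> annulus R" for n
  proof
    fix z :: pt assume "z \<in> {a..b} \<times> {- (\<delta> / Suc n)..\<delta> / Suc n}"
    then obtain x y where z: "z = (x, y)" "a \<le> x" "x \<le> b" "\<bar>y\<bar> \<le> \<delta> / Suc n" by (auto simp: abs_le_iff)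
    have "\<delta> / Suc n \<le> \<delta>" using ab by (simp add: field_simps)
    then have "norm (x, y) \<le> b + \<delta>" using norm_Pair_le[of x y] z ab by simp
    moreover have "norm (x, y) \<ge> a" using norm_fst_le[of x y] z ab by simp
    ultimately show "z \<in> annulus R" using ab z by (simp add: annulus_def)
  qed
  have test: "test_fun (annulus R) (\<phi> n)" for n
    unfolding \<phi>_def by (rule test_fun_box_bump[OF _ _ sub]) auto
  define f where "f = (\<lambda>x. bump 0 (x - a) * bump 0 (b - x) * (bump 0 \<delta> * bump 0 \<delta>))"
  have slit: "\<phi> n (x, 0) = f x" for n x
    by (simp add: \<phi>_def f_def box_bump_def)
  define K where "K = integral {1..R} f"
  have cb: "continuous_on S (bump 0)" for S
    using bump_deriv DERIV_isCont continuous_at_imp_continuous_on by blast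
  have "K \<noteq> 0"
  proof
    assume "K = 0"
    moreover have "continuous_on {1..R} f" unfolding f_def
      by (intro continuous_intros continuous_on_compose2[OF cb[of UNIV]]) auto
    ultimately have "\<forall>x\<in>{1..R}. f x = 0"
      \<comment> \<open>A continuous nonnegative integrand with zero integral vanishes, which is
        refuted at the midpoint of a and b.\<close>
      unfolding K_def using R by (subst (asm) integral_eq_0_iff) (auto simp: f_def bump_nonneg)
    then have "f ((a + b) / 2) = 0" using ab by auto
    then show False using ab by (auto simp: f_def bump_def field_simps)
  qed
  have "(\<lambda>n. LINT x|?M. (g x - Q x) * \<phi> n x) \<longlonglongrightarrow> (LINT x|?M. 0)"
  proof (rule integral_dominated_convergence[where w="\<lambda>x. \<bar>g x - Q x\<bar>"])
    show "AE x in ?M. (\<lambda>n. (g x - Q x) * \<phi> n x) \<longlonglongrightarrow> 0"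
      using AE_off_axes[OF annulus_props(3)[of R]]
    proof eventually_elim
      case (elim x)
      \<comment> \<open>A point off the horizontal axis leaves the shrinking strips once
        \<open>\<delta> / Suc n\<close> is below its distance from the axis.\<close>
      obtain N where N: "\<delta> / \<bar>snd x\<bar> < real N" using reals_Archimedean2 by blast
      have "\<phi> n x = 0" if "n \<ge> N" for n
      proof -
        have "\<delta> / \<bar>snd x\<bar> < real (Suc n)" using N that by linarith
        then have "\<delta> / Suc n < \<bar>snd x\<bar>" using elim by (simp add: field_simps)
        then have "\<not> (snd x - - (\<delta> / Suc n) > 0 \<and> \<delta> / Suc n - snd x > 0)" by linarith
        then have "bump 0 (Suc n * (snd x - - (\<delta> / Suc n))) = 0 \<or> bump 0 (Suc n * (\<delta> / Suc n - snd x)) = 0"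
          unfolding bump_def by (simp only: zero_less_mult_iff of_nat_0_less_iff) auto
        then show ?thesis unfolding \<phi>_def box_bump_def by auto
      qed
      then have "eventually (\<lambda>n. (g x - Q x) * \<phi> n x = 0) sequentially"
        by (auto simp: eventually_sequentially)
      then show ?case by (rule tendsto_eventually)
    qed
    show "AE x in ?M. norm ((g x - Q x) * \<phi> n x) \<le> \<bar>g x - Q x\<bar>" for n
      unfolding \<phi>_def by (simp add: abs_mult box_bump_bounds mult_left_le)
    show "(\<lambda>x. (g x - Q x) * \<phi> n x) \<in> borel_measurable ?M" for n
      by (rule borel_measurable_times[OF borel_measurable_integrable[OF h]
            bounded_borel_measurable[OF annulus_props(3) bounded_borel_C1_compact(1)[OF test_fun_C1_compact_real[OF test] annulus_props(3)]]])
  qed (use h in auto)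
  then have "(\<lambda>n. 2 * pi * lam * K) \<longlonglongrightarrow> 0"
    by (simp add: key[OF test] slit K_def)
  then show False using \<open>K \<noteq> 0\<close> lam by (simp add: LIMSEQ_const_iff)
qed

theorem theorem3p6:
  fixes R \<omega> :: real
  assumes "R > 1" and "\<omega> \<ge> 0"
  shows "(\<forall>lam. smooth_up_to_closure (annulus R) (v_lam R \<omega> lam)
            \<and> incomplete_solution R \<omega> (\<lambda>_. 0) (v_lam R \<omega> lam)
            \<and> is_pressure R (v_lam R \<omega> lam) (q_lam R \<omega> lam))
       \<and> (\<forall>lam mu. lam \<noteq> mu \<longrightarrow>
            \<not> (AE \<xi> in lebesgue_on (annulus R). v_lam R \<omega> lam \<xi> = v_lam R \<omega> mu \<xi>))
       \<and> (\<forall>lam. lam \<noteq> 0 \<longrightarrow>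
            (\<forall>x\<in>{1<..<R}. \<not> continuous (at (x, 0) within annulus R) (q_lam R \<omega> lam))
            \<and> \<not> H1 (annulus R) (q_lam R \<omega> lam))"
  using smooth_v_lam incomplete_solution_v_lam[OF assms(1)] is_pressure_q_lam
    v_lam_distinct[OF assms(1)] q_lam_discontinuous q_lam_not_H1[OF assms(1)]
  by (intro conjI allI impI ballI) (auto simp: greaterThanLessThan_iff)

end
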